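(* Let $u:\mathbb{R}\to\mathbb{R}$ be a smooth function, and for each mesh size $\Delta x>0$ let $R_i(x)=R_i^{(0)}+R_i^{(1)}(x-x_i)+\frac12R_i^{(2)}(x-x_i)^2$ be either the CWENO23 or the CWENO23Z reconstruction obtained from the cell averages $\bar u_i$ of $u$ on the uniform grid $x_i=i\Delta x$, $i\in\mathbb{Z}$. Then $$u(x_i)=R_i^{(0)}+\mathcal{O}(\Delta x^4),\qquad u''(x_i)=R_i^{(2)}+\mathcal{O}(\Delta x^2),$$ $$u'(x_i)-u'(x_{i+1})=R_i^{(1)}-R_{i+1}^{(1)}+\mathcal{O}(\Delta x^3).$$ Consequently, for any $\theta\in[0,1)$, the corresponding reconstruction $Q_{i+\theta}$ is fourth order accurate: $Q_{i+\theta}=\bar u(x_i+\theta\Delta x)+\mathcal{O}(\Delta x^4)$.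
   Context: Sliding average: $\bar u(x)=\frac1{\Delta x}\int_{x-\Delta x/2}^{x+\Delta x/2}u(y)\,dy$; cell averages $\bar u_i=\bar u(x_i)$. Put $x_{i\pm\frac12}=x_i\pm\Delta x/2$, $x_{i\pm\frac12+\theta}=x_{i\pm\frac12}+\theta\Delta x$. The reconstruction $Q$ built from $(R_i)$ is $$Q_{i+\theta}=\frac1{\Delta x}\int_{x_{i-\frac12+\theta}}^{x_{i+\frac12}}R_i(x)\,dx+\frac1{\Delta x}\int_{x_{i+\frac12}}^{x_{i+\frac12+\theta}}R_{i+1}(x)\,dx .$$ CWENO23 and CWENO23Z coefficients: given nonlinear weights $\omega_L^i,\omega_C^i,\omega_R^i\ge 0$ with $\omega_L^i+\omega_C^i+\omega_R^i=1$, $$R_i^{(0)}=\bar u_i-\tfrac1{12}\omega_C^i(\bar u_{i+1}-2\bar u_i+\bar u_{i-1}),$$ $$R_i^{(1)}=\omega_L^i\frac{\bar u_i-\bar u_{i-1}}{\Delta x}+\omega_R^i\frac{\bar u_{i+1}-\bar u_i}{\Delta x}+\omega_C^i\frac{\bar u_{i+1}-\bar u_{i-1}}{2\Delta x},$$ $$R_i^{(2)}=2\omega_C^i\frac{\bar u_{i+1}-2\bar u_i+\bar u_{i-1}}{(\Delta x)^2}.$$ Linear weights: $C_L=C_R=\frac14$, $C_C=\frac12$. Smoothness indicators: $$\beta_L^i=(\bar u_i-\bar u_{i-1})^2,\quad \beta_R^i=(\bar u_{i+1}-\bar u_i)^2,\quad \beta_C^i=\tfrac{13}{3}(\bar u_{i+1}-2\bar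 u_i+\bar u_{i-1})^2+\tfrac14(\bar u_{i+1}-\bar u_{i-1})^2.$$ The nonlinear weights are $\omega_m^i=a_m^i/(a_L^i+a_C^i+a_R^i)$, $m\in\{L,C,R\}$, where - CWENO23: $a_m^i=\dfrac{C_m}{(\epsilon+\beta_m^i)^p}$ with $p=2$; - CWENO23Z: $a_m^i=C_m\Big(1+\dfrac{\tau^i}{\epsilon+\beta_m^i}\Big)^p$ with $p\ge1$ fixed and $\tau^i=|\beta_R^i-\beta_L^i|$. The parameter is $\epsilon=(\Delta x)^2$ or $\epsilon=10^{-6}$ (either choice, in both cases). The $\mathcal{O}$ symbols refer to $\Delta x\to0$, with implied constants uniform over the indices $i$ for which $x_i$ lies in any fixed bounded set. *)

theory Defs
  imports "HOL-Analysis.Analysis"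
begin

definition smooth :: "(real \<Rightarrow> real) \<Rightarrow> bool" where
  "smooth u \<longleftrightarrow> (\<forall>k x. ((deriv ^^ k) u) differentiable (at x))"

definition grid :: "real \<Rightarrow> int \<Rightarrow> real" where
  "grid h i = of_int i * h"

definition sliding_avg :: "(real \<Rightarrow> real) \<Rightarrow> real \<Rightarrow> real \<Rightarrow> real" where
  "sliding_avg u h x = (1 / h) * integral {x - h / 2 .. x + h / 2} u"

definition cell_avg :: "(real \<Rightarrow> real) \<Rightarrow> real \<Rightarrow> int \<Rightarrow> real" where
  "cell_avg u h i = sliding_avg u h (grid h i)"

datatype stencil = SL | SC | SR

(* CWENO23Z carries its exponent p; the exponent of CWENO23 is 2. *)
datatype scheme = CWENO23 | CWENO23Z real

fun lin_weight :: "stencil \<Rightarrow> real" where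
  "lin_weight SL = 1 / 4"
| "lin_weight SC = 1 / 2"
| "lin_weight SR = 1 / 4"

(* In the following, v is the sequence of cell averages and e the parameter epsilon. *)

fun smoothness :: "(int \<Rightarrow> real) \<Rightarrow> stencil \<Rightarrow> int \<Rightarrow> real" where
  "smoothness v SL i = (v i - v (i - 1))\<^sup>2"
| "smoothness v SR i = (v (i + 1) - v i)\<^sup>2"
| "smoothness v SC i =
     13 / 3 * (v (i + 1) - 2 * v i + v (i - 1))\<^sup>2 + 1 / 4 * (v (i + 1) - v (i - 1))\<^sup>2"

definition tau :: "(int \<Rightarrow> real) \<Rightarrow> int \<Rightarrow> real" where
  "tau v i = \<bar>smoothness v SR i - smoothness v SL i\<bar>"

fun raw_weight :: "scheme \<Rightarrow> real \<Rightarrow> (int \<Rightarrow> real) \<Rightarrow> stencil \<Rightarrow> int \<Rightarrow> real" where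
  "raw_weight CWENO23 e v m i = lin_weight m / (e + smoothness v m i)\<^sup>2"
| "raw_weight (CWENO23Z p) e v m i =
     lin_weight m * (1 + tau v i / (e + smoothness v m i)) powr p"

definition weight :: "scheme \<Rightarrow> real \<Rightarrow> (int \<Rightarrow> real) \<Rightarrow> stencil \<Rightarrow> int \<Rightarrow> real" where
  "weight s e v m i =
     raw_weight s e v m i / (raw_weight s e v SL i + raw_weight s e v SC i + raw_weight s e v SR i)"

(* Coefficients for arbitrary nonlinear weights w. *)

definition coeff0 :: "(stencil \<Rightarrow> int \<Rightarrow> real) \<Rightarrow> (int \<Rightarrow> real) \<Rightarrow> int \<Rightarrow> real" where
  "coeff0 w v i = v i - 1 / 12 * w SC i * (v (i + 1) - 2 * v i + v (i - 1))"

definition coeff1 :: "(stencil \<Rightarrow> int \<Rightarrow> real) \<Rightarrow> real \<Rightarrow> (int \<Rightarrow> real) \<Rightarrow> int \<Rightarrow> real" where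
  "coeff1 w h v i =
     w SL i * ((v i - v (i - 1)) / h) + w SR i * ((v (i + 1) - v i) / h)
     + w SC i * ((v (i + 1) - v (i - 1)) / (2 * h))"

definition coeff2 :: "(stencil \<Rightarrow> int \<Rightarrow> real) \<Rightarrow> real \<Rightarrow> (int \<Rightarrow> real) \<Rightarrow> int \<Rightarrow> real" where
  "coeff2 w h v i = 2 * w SC i * ((v (i + 1) - 2 * v i + v (i - 1)) / h\<^sup>2)"

(* Here eps is the parameter as a function of the mesh size. *)

definition R0 :: "scheme \<Rightarrow> (real \<Rightarrow> real) \<Rightarrow> (real \<Rightarrow> real) \<Rightarrow> real \<Rightarrow> int \<Rightarrow> real" where
  "R0 s eps u h i = coeff0 (weight s (eps h) (cell_avg u h)) (cell_avg u h) i"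

definition R1 :: "scheme \<Rightarrow> (real \<Rightarrow> real) \<Rightarrow> (real \<Rightarrow> real) \<Rightarrow> real \<Rightarrow> int \<Rightarrow> real" where
  "R1 s eps u h i = coeff1 (weight s (eps h) (cell_avg u h)) h (cell_avg u h) i"

definition R2 :: "scheme \<Rightarrow> (real \<Rightarrow> real) \<Rightarrow> (real \<Rightarrow> real) \<Rightarrow> real \<Rightarrow> int \<Rightarrow> real" where
  "R2 s eps u h i = coeff2 (weight s (eps h) (cell_avg u h)) h (cell_avg u h) i"

definition Rpoly :: "scheme \<Rightarrow> (real \<Rightarrow> real) \<Rightarrow> (real \<Rightarrow> real) \<Rightarrow> real \<Rightarrow> int \<Rightarrow> real \<Rightarrow> real" where
  "Rpoly s eps u h i x =
     R0 s eps u h i + R1 s eps u h i * (x - grid h i)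
     + 1 / 2 * R2 s eps u h i * (x - grid h i)\<^sup>2"

(* The intervals are properly oriented for 0 \<le> \<theta> \<le> 1. *)
definition Q :: "scheme \<Rightarrow> (real \<Rightarrow> real) \<Rightarrow> (real \<Rightarrow> real) \<Rightarrow> real \<Rightarrow> int \<Rightarrow> real \<Rightarrow> real" where
  "Q s eps u h i \<theta> =
     (1 / h) * integral {grid h i - h / 2 + \<theta> * h .. grid h i + h / 2} (Rpoly s eps u h i)
     + (1 / h) * integral {grid h i + h / 2 .. grid h i + h / 2 + \<theta> * h} (Rpoly s eps u h (i + 1))"

(* E h i = O(h^n) as h tends to 0 from above, with a constant uniform over the
   indices i for which the grid point lies in any fixed bounded set. *)
definition grid_bigo :: "nat \<Rightarrow> (real \<Rightarrow> int \<Rightarrow> real) \<Rightarrow> bool" where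
  "grid_bigo n E \<longleftrightarrow>
     (\<forall>B. bounded B \<longrightarrow>
       (\<exists>K. \<forall>\<^sub>F h in at_right 0. \<forall>i. grid h i \<in> B \<longrightarrow> \<bar>E h i\<bar> \<le> K * h ^ n))"

end

(* Put G_m = beta_m / h^2. The three G_m agree with u'^2 up to O(h), and G_L, G_R deviate from G_C by
   -h u' u'' and +h u' u'' up to O(h^2). Since epsilon / h^2 >= 1 for small h, the ratios of the
   lateral weights to the central one (normalised by the linear weights) are therefore 1 + h F + O(h^2)
   on the left and 1 - h F + O(h^2) on the right, where F is uniformly Lipschitz on the grid (F = 0 for
   CWENO23Z). Hence omega_C = 1/2 + O(h^2), while omega_R - omega_L is O(h) with jumps O(h^2) between
   neighbouring cells; this gives the three coefficient estimates. In Q, the moments of odd order over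
   the two adjacent part-cells are opposite, so only the jump of R^(1) - u' matters. *)

theory Submission
  imports Defs
begin

section \<open>Calculus of grid error terms\<close>

text \<open>The obstacle is a critical point of u, where all indicators may be arbitrarily small.
  The lower bound on epsilon / h^2 makes every denominator at least 1 after scaling, so quotients
  cost no order and no case distinction on u' is needed. For fixed epsilon, epsilon / h^2 is
  unbounded, which is why the weights are compared through their ratios to the central one instead
  of being expanded individually. For CWENO23 the ratio is a square (1 + z)^2 with z = O(h), whence
  F = 2 u' u'' / (epsilon / h^2 + u'^2). For CWENO23Z, tau / h^2 is already O(h) and multiplies a
  difference of two indicators, again O(h), so no term of order h is left. R^(1) itself misses u' by
  O(h^2): by 5/24 h^2 u''' from the averaging, and by half of (omega_R - omega_L) times h u'' from
  the asymmetry of the weights. Both errors vary slowly along the grid, so their jumps are O(h^3).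
  Each estimate rests on an exact identity that writes the error as a combination of terms of known
  order.\<close>

lemma eventually_at_right_0I:
  assumes "0 < d" "\<And>h::real. 0 < h \<Longrightarrow> h < d \<Longrightarrow> P h"
  shows "\<forall>\<^sub>F h in at_right 0. P h"
  using assms unfolding eventually_at_right_field by auto

text \<open>Symmetric intervals can be enlarged explicitly when an index is shifted, and a
  nonnegative constant keeps products of bounds monotone.\<close>

lemma grid_bigo_iff:
  "grid_bigo n E \<longleftrightarrow>
    (\<forall>A. \<exists>K\<ge>0. \<forall>\<^sub>F h in at_right 0. \<forall>i. \<bar>grid h i\<bar> \<le> A \<longrightarrow> \<bar>E h i\<bar> \<le> K * h ^ n)"
proof (intro iffI allI)
  fix A :: real
  assume "grid_bigo n E"
  moreover have "bounded (cball (0::real) A)"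
    by (rule bounded_cball)
  ultimately obtain K where K: "\<forall>\<^sub>F h in at_right 0. \<forall>i. grid h i \<in> cball 0 A \<longrightarrow> \<bar>E h i\<bar> \<le> K * h ^ n"
    unfolding grid_bigo_def by blast
  have "\<forall>\<^sub>F h in at_right 0. \<forall>i. \<bar>grid h i\<bar> \<le> A \<longrightarrow> \<bar>E h i\<bar> \<le> \<bar>K\<bar> * h ^ n"
    using K eventually_at_right_less[of "0::real"]
  proof eventually_elim
    case (elim h)
    have "K * h ^ n \<le> \<bar>K\<bar> * h ^ n"
      using elim by (intro mult_right_mono) auto
    with elim show ?case
      by (auto intro: order_trans)
  qed
  then show "\<exists>K\<ge>0. \<forall>\<^sub>F h in at_right 0. \<forall>i. \<bar>grid h i\<bar> \<le> A \<longrightarrow> \<bar>E h i\<bar> \<le> K * h ^ n"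
    by (intro exI[of _ "\<bar>K\<bar>"]) auto
next
  assume R: "\<forall>A. \<exists>K\<ge>0. \<forall>\<^sub>F h in at_right 0. \<forall>i. \<bar>grid h i\<bar> \<le> A \<longrightarrow> \<bar>E h i\<bar> \<le> K * h ^ n"
  show "grid_bigo n E"
    unfolding grid_bigo_def
  proof (intro allI impI)
    fix B :: "real set"
    assume "bounded B"
    then obtain A where A: "\<And>x. x \<in> B \<Longrightarrow> \<bar>x\<bar> \<le> A"
      by (auto simp: bounded_iff)
    obtain K where "\<forall>\<^sub>F h in at_right 0. \<forall>i. \<bar>grid h i\<bar> \<le> A \<longrightarrow> \<bar>E h i\<bar> \<le> K * h ^ n"
      using R by blast
    then have "\<forall>\<^sub>F h in at_right 0. \<forall>i. grid h i \<in> B \<longrightarrow> \<bar>E h i\<bar> \<le> K * h ^ n"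
      by eventually_elim (use A in blast)
    then show "\<exists>K. \<forall>\<^sub>F h in at_right 0. \<forall>i. grid h i \<in> B \<longrightarrow> \<bar>E h i\<bar> \<le> K * h ^ n" ..
  qed
qed

text \<open>The vehicle for all later estimates: \<open>E\<close> is assembled from terms of known
  order, and an algebraic identity valid for small mesh sizes identifies it with the error
  \<open>F\<close>.\<close>

lemma grid_bigo_cong_ev:
  assumes "grid_bigo n E" "\<forall>\<^sub>F h in at_right 0. \<forall>i. F h i = E h i"
  shows "grid_bigo n F"
  unfolding grid_bigo_def
proof (intro allI impI)
  fix B :: "real set"
  assume "bounded B"
  then obtain K where "\<forall>\<^sub>F h in at_right 0. \<forall>i. grid h i \<in> B \<longrightarrow> \<bar>E h i\<bar> \<le> K * h ^ n"
    using assms(1) unfolding grid_bigo_def by blast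
  with assms(2) have "\<forall>\<^sub>F h in at_right 0. \<forall>i. grid h i \<in> B \<longrightarrow> \<bar>F h i\<bar> \<le> K * h ^ n"
    by eventually_elim simp
  then show "\<exists>K. \<forall>\<^sub>F h in at_right 0. \<forall>i. grid h i \<in> B \<longrightarrow> \<bar>F h i\<bar> \<le> K * h ^ n" ..
qed

lemma grid_bigo_cong:
  assumes "grid_bigo n E" "\<And>h i. 0 < h \<Longrightarrow> F h i = E h i"
  shows "grid_bigo n F"
  using assms(1)
  by (rule grid_bigo_cong_ev) (intro eventually_at_right_0I[of 1] allI assms(2), auto)

lemma grid_bigo_mult:
  assumes "grid_bigo m E" "grid_bigo n F" "k \<le> m + n"
  shows "grid_bigo k (\<lambda>h i. E h i * F h i)"
  unfolding grid_bigo_iff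
proof
  fix A :: real
  obtain K L where "K \<ge> 0" "L \<ge> 0"
    and K: "\<forall>\<^sub>F h in at_right 0. \<forall>i. \<bar>grid h i\<bar> \<le> A \<longrightarrow> \<bar>E h i\<bar> \<le> K * h ^ m"
    and L: "\<forall>\<^sub>F h in at_right 0. \<forall>i. \<bar>grid h i\<bar> \<le> A \<longrightarrow> \<bar>F h i\<bar> \<le> L * h ^ n"
    using assms(1,2) unfolding grid_bigo_iff by meson
  have small: "\<forall>\<^sub>F h::real in at_right 0. 0 < h \<and> h \<le> 1"
    by (rule eventually_at_right_0I[of 1]) auto
  have "\<forall>\<^sub>F h in at_right 0. \<forall>i. \<bar>grid h i\<bar> \<le> A \<longrightarrow> \<bar>E h i * F h i\<bar> \<le> (K * L) * h ^ k"
    using K L small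
  proof eventually_elim
    case (elim h)
    show ?case
    proof (intro allI impI)
      fix i
      assume "\<bar>grid h i\<bar> \<le> A"
      then have "\<bar>E h i * F h i\<bar> \<le> (K * h ^ m) * (L * h ^ n)"
        unfolding abs_mult using elim \<open>K \<ge> 0\<close> by (intro mult_mono) auto
      also have "\<dots> = (K * L) * h ^ (m + n)"
        by (simp add: power_add)
      also have "\<dots> \<le> (K * L) * h ^ k"
        using elim assms(3) \<open>K \<ge> 0\<close> \<open>L \<ge> 0\<close> by (intro mult_left_mono power_decreasing) auto
      finally show "\<bar>E h i * F h i\<bar> \<le> (K * L) * h ^ k" .
    qed
  qed
  then show "\<exists>K\<ge>0. \<forall>\<^sub>F h in at_right 0. \<forall>i. \<bar>grid h i\<bar> \<le> A \<longrightarrow> \<bar>E h i * F h i\<bar> \<le> K * h ^ k"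
    using \<open>K \<ge> 0\<close> \<open>L \<ge> 0\<close> by (intro exI[of _ "K * L"]) auto
qed

lemma grid_bigo_const: "grid_bigo 0 (\<lambda>h i. c)"
  unfolding grid_bigo_iff by (intro allI exI[of _ "\<bar>c\<bar>"]) auto

lemma grid_bigo_power: "grid_bigo n (\<lambda>h i. h ^ n)"
  unfolding grid_bigo_iff
  by (intro allI exI[of _ 1] conjI eventually_at_right_0I[of 1]) auto

lemma grid_bigo_mono: "grid_bigo m E \<Longrightarrow> n \<le> m \<Longrightarrow> grid_bigo n E"
  using grid_bigo_mult[of m E 0 "\<lambda>h i. 1" n] grid_bigo_const[of 1] by simp

lemma grid_bigo_cmult: "grid_bigo n E \<Longrightarrow> grid_bigo n (\<lambda>h i. c * E h i)"
  using grid_bigo_mult[OF grid_bigo_const, of n E n c] by simp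

lemma grid_bigo_power_mult: "grid_bigo m E \<Longrightarrow> n \<le> k + m \<Longrightarrow> grid_bigo n (\<lambda>h i. h ^ k * E h i)"
  by (rule grid_bigo_mult[OF grid_bigo_power])

lemma grid_bigo_add:
  assumes "grid_bigo n E" "grid_bigo n F"
  shows "grid_bigo n (\<lambda>h i. E h i + F h i)"
  unfolding grid_bigo_iff
proof
  fix A :: real
  obtain K L where "K \<ge> 0" "L \<ge> 0"
    and K: "\<forall>\<^sub>F h in at_right 0. \<forall>i. \<bar>grid h i\<bar> \<le> A \<longrightarrow> \<bar>E h i\<bar> \<le> K * h ^ n"
    and L: "\<forall>\<^sub>F h in at_right 0. \<forall>i. \<bar>grid h i\<bar> \<le> A \<longrightarrow> \<bar>F h i\<bar> \<le> L * h ^ n"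
    using assms unfolding grid_bigo_iff by meson
  from K L have "\<forall>\<^sub>F h in at_right 0. \<forall>i. \<bar>grid h i\<bar> \<le> A \<longrightarrow> \<bar>E h i + F h i\<bar> \<le> (K + L) * h ^ n"
  proof eventually_elim
    case (elim h)
    then show ?case
      unfolding distrib_right by (meson abs_triangle_ineq add_mono order_trans)
  qed
  then show "\<exists>K\<ge>0. \<forall>\<^sub>F h in at_right 0. \<forall>i. \<bar>grid h i\<bar> \<le> A \<longrightarrow> \<bar>E h i + F h i\<bar> \<le> K * h ^ n"
    using \<open>K \<ge> 0\<close> \<open>L \<ge> 0\<close> by (intro exI[of _ "K + L"]) auto
qed

lemma grid_bigo_diff:
  assumes "grid_bigo n E" "grid_bigo n F"
  shows "grid_bigo n (\<lambda>h i. E h i - F h i)"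
  using grid_bigo_add[OF assms(1) grid_bigo_cmult[OF assms(2), of "-1"]] by simp

lemma grid_bigo_abs: "grid_bigo n E \<Longrightarrow> grid_bigo n (\<lambda>h i. \<bar>E h i\<bar>)"
  unfolding grid_bigo_def by simp

lemma grid_bigo_divide_h:
  assumes "grid_bigo (Suc n) E"
  shows "grid_bigo n (\<lambda>h i. E h i / h)"
  unfolding grid_bigo_def
proof (intro allI impI)
  fix B :: "real set"
  assume "bounded B"
  then obtain K where K: "\<forall>\<^sub>F h in at_right 0. \<forall>i. grid h i \<in> B \<longrightarrow> \<bar>E h i\<bar> \<le> K * h ^ Suc n"
    using assms unfolding grid_bigo_def by blast
  have "\<forall>\<^sub>F h in at_right 0. \<forall>i. grid h i \<in> B \<longrightarrow> \<bar>E h i / h\<bar> \<le> K * h ^ n"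
    using K eventually_at_right_less[of "0::real"]
    by eventually_elim (auto simp: abs_divide divide_le_eq mult_ac)
  then show "\<exists>K. \<forall>\<^sub>F h in at_right 0. \<forall>i. grid h i \<in> B \<longrightarrow> \<bar>E h i / h\<bar> \<le> K * h ^ n" ..
qed

text \<open>A lower bound of 1 means that division loses no power of h. The denominators of the
  scaled weights are all of this kind.\<close>

lemma grid_bigo_divide:
  assumes "grid_bigo n E" "\<forall>\<^sub>F h in at_right 0. \<forall>i. 1 \<le> F h i"
  shows "grid_bigo n (\<lambda>h i. E h i / F h i)"
  unfolding grid_bigo_def
proof (intro allI impI)
  fix B :: "real set"
  assume "bounded B"
  then obtain K where "\<forall>\<^sub>F h in at_right 0. \<forall>i. grid h i \<in> B \<longrightarrow> \<bar>E h i\<bar> \<le> K * h ^ n"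
    using assms(1) unfolding grid_bigo_def by blast
  with assms(2) have "\<forall>\<^sub>F h in at_right 0. \<forall>i. grid h i \<in> B \<longrightarrow> \<bar>E h i / F h i\<bar> \<le> K * h ^ n"
  proof eventually_elim
    case (elim h)
    show ?case
    proof (intro allI impI)
      fix i
      assume i: "grid h i \<in> B"
      have F: "1 \<le> F h i"
        using elim by blast
      then have "\<bar>E h i\<bar> / F h i \<le> \<bar>E h i\<bar> / 1"
        by (intro divide_left_mono) auto
      also have "\<dots> \<le> K * h ^ n"
        using elim i by simp
      finally show "\<bar>E h i / F h i\<bar> \<le> K * h ^ n"
        using F by (simp add: abs_divide)
    qed
  qed
  then show "\<exists>K. \<forall>\<^sub>F h in at_right 0. \<forall>i. grid h i \<in> B \<longrightarrow> \<bar>E h i / F h i\<bar> \<le> K * h ^ n" ..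
qed

lemma grid_Suc: "grid h (i + 1) = grid h i + h"
  by (simp add: grid_def algebra_simps)

text \<open>The neighbouring grid point lies at distance h, at most 1, so the constant belonging to
  the radius \<open>A + 1\<close> serves for the radius \<open>A\<close>.\<close>

lemma grid_bigo_shift:
  assumes "grid_bigo n E"
  shows "grid_bigo n (\<lambda>h i. E h (i + 1))"
  unfolding grid_bigo_iff
proof
  fix A :: real
  obtain K where "K \<ge> 0"
    and K: "\<forall>\<^sub>F h in at_right 0. \<forall>i. \<bar>grid h i\<bar> \<le> A + 1 \<longrightarrow> \<bar>E h i\<bar> \<le> K * h ^ n"
    using assms unfolding grid_bigo_iff by meson
  have "\<forall>\<^sub>F h::real in at_right 0. 0 < h \<and> h \<le> 1"
    by (rule eventually_at_right_0I[of 1]) auto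
  with K have "\<forall>\<^sub>F h in at_right 0. \<forall>i. \<bar>grid h i\<bar> \<le> A \<longrightarrow> \<bar>E h (i + 1)\<bar> \<le> K * h ^ n"
  proof eventually_elim
    case (elim h)
    show ?case
    proof (intro allI impI)
      fix i
      assume "\<bar>grid h i\<bar> \<le> A"
      then have "\<bar>grid h (i + 1)\<bar> \<le> A + 1"
        using elim unfolding grid_Suc by linarith
      with elim show "\<bar>E h (i + 1)\<bar> \<le> K * h ^ n"
        by blast
    qed
  qed
  then show "\<exists>K\<ge>0. \<forall>\<^sub>F h in at_right 0. \<forall>i. \<bar>grid h i\<bar> \<le> A \<longrightarrow> \<bar>E h (i + 1)\<bar> \<le> K * h ^ n"
    using \<open>K \<ge> 0\<close> by blast
qed

text \<open>The difference quotient of x powr p at 1 tends to p, hence is within 1 of p near there;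
  this is the origin of the factor |p| + 1.\<close>

lemma powr_near_1:
  fixes p :: real
  obtains d where "0 < d" "\<And>z. \<bar>z\<bar> < d \<Longrightarrow> \<bar>(1 + z) powr p - 1\<bar> \<le> (\<bar>p\<bar> + 1) * \<bar>z\<bar>"
proof -
  have "((\<lambda>x. x powr p) has_real_derivative p) (at 1)"
    using has_real_derivative_powr[of 1 p] by simp
  then have "(\<lambda>z. ((1 + z) powr p - 1) / z) \<midarrow>0\<rightarrow> p"
    by (simp add: DERIV_def)
  from LIM_D[OF this, of 1] obtain d
    where "d > 0" and d: "\<And>z. z \<noteq> 0 \<Longrightarrow> \<bar>z\<bar> < d \<Longrightarrow> \<bar>((1 + z) powr p - 1) / z - p\<bar> < 1"
    by auto
  show thesis
  proof (rule that[OF \<open>d > 0\<close>])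
    fix z :: real
    assume z: "\<bar>z\<bar> < d"
    show "\<bar>(1 + z) powr p - 1\<bar> \<le> (\<bar>p\<bar> + 1) * \<bar>z\<bar>"
    proof (cases "z = 0")
      case False
      with d z have "\<bar>((1 + z) powr p - 1) / z\<bar> \<le> \<bar>p\<bar> + 1"
        by fastforce
      with False show ?thesis
        by (simp add: abs_divide divide_le_eq)
    qed simp
  qed
qed

text \<open>The order must be at least one, hence \<open>Suc n\<close>: only then does the
  perturbation eventually enter the neighbourhood in which \<open>powr_near_1\<close>
  applies.\<close>

lemma grid_bigo_powr:
  assumes "grid_bigo (Suc n) E"
  shows "grid_bigo (Suc n) (\<lambda>h i. (1 + E h i) powr p - 1)"
  unfolding grid_bigo_iff
proof
  fix A :: real
  obtain d where "d > 0" and d: "\<And>z. \<bar>z\<bar> < d \<Longrightarrow> \<bar>(1 + z) powr p - 1\<bar> \<le> (\<bar>p\<bar> + 1) * \<bar>z\<bar>"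
    using powr_near_1 by blast
  obtain K where "K \<ge> 0"
    and K: "\<forall>\<^sub>F h in at_right 0. \<forall>i. \<bar>grid h i\<bar> \<le> A \<longrightarrow> \<bar>E h i\<bar> \<le> K * h ^ Suc n"
    using assms unfolding grid_bigo_iff by meson
  have "((\<lambda>h. K * h ^ Suc n) \<longlongrightarrow> K * 0 ^ Suc n) (at_right 0)"
    by (intro tendsto_intros)
  then have "\<forall>\<^sub>F h in at_right 0. K * h ^ Suc n < d"
    by (rule order_tendstoD) (use \<open>d > 0\<close> in simp)
  with K have "\<forall>\<^sub>F h in at_right 0. \<forall>i. \<bar>grid h i\<bar> \<le> A \<longrightarrow>
      \<bar>(1 + E h i) powr p - 1\<bar> \<le> ((\<bar>p\<bar> + 1) * K) * h ^ Suc n"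
  proof eventually_elim
    case (elim h)
    show ?case
    proof (intro allI impI)
      fix i
      assume "\<bar>grid h i\<bar> \<le> A"
      then have E: "\<bar>E h i\<bar> \<le> K * h ^ Suc n"
        using elim by blast
      then have "\<bar>(1 + E h i) powr p - 1\<bar> \<le> (\<bar>p\<bar> + 1) * \<bar>E h i\<bar>"
        using elim d by (meson order_le_less_trans)
      also have "\<dots> \<le> (\<bar>p\<bar> + 1) * (K * h ^ Suc n)"
        using E by (intro mult_left_mono) auto
      finally show "\<bar>(1 + E h i) powr p - 1\<bar> \<le> ((\<bar>p\<bar> + 1) * K) * h ^ Suc n"
        by (simp add: mult.assoc)
    qed
  qed
  then show "\<exists>K\<ge>0. \<forall>\<^sub>F h in at_right 0. \<forall>i. \<bar>grid h i\<bar> \<le> A \<longrightarrow>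
      \<bar>(1 + E h i) powr p - 1\<bar> \<le> K * h ^ Suc n"
    using \<open>K \<ge> 0\<close> by (intro exI[of _ "(\<bar>p\<bar> + 1) * K"]) auto
qed

section \<open>Taylor expansion of averages\<close>

text \<open>The endpoints are measured in cell widths from x, so that every moment carries its power
  of h. The formula serves the Taylor polynomial of u and, with \<open>c3 = 0\<close>, the
  reconstruction polynomial.\<close>

lemma has_integral_cubic:
  fixes x a b h c0 c1 c2 c3 :: real
  assumes "0 < h" "a \<le> b"
  shows "((\<lambda>y. c0 + c1 * (y - x) + 1 / 2 * c2 * (y - x)\<^sup>2 + 1 / 6 * c3 * (y - x) ^ 3) has_integral
    h * (c0 * (b - a) + c1 * h * (b\<^sup>2 - a\<^sup>2) / 2 + c2 * h\<^sup>2 * (b ^ 3 - a ^ 3) / 6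
      + c3 * h ^ 3 * (b ^ 4 - a ^ 4) / 24)) {x + a * h .. x + b * h}"
proof -
  let ?P = "\<lambda>y. c0 * (y - x) + c1 * (y - x)\<^sup>2 / 2 + c2 * (y - x) ^ 3 / 6 + c3 * (y - x) ^ 4 / 24"
  have "((\<lambda>y. c0 + c1 * (y - x) + 1 / 2 * c2 * (y - x)\<^sup>2 + 1 / 6 * c3 * (y - x) ^ 3) has_integral
      ?P (x + b * h) - ?P (x + a * h)) {x + a * h .. x + b * h}"
  proof (rule fundamental_theorem_of_calculus)
    show "x + a * h \<le> x + b * h"
      using assms by (simp add: mult_right_mono)
    show "(?P has_vector_derivative
        c0 + c1 * (y - x) + 1 / 2 * c2 * (y - x)\<^sup>2 + 1 / 6 * c3 * (y - x) ^ 3)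
        (at y within {x + a * h .. x + b * h})" for y
      unfolding has_real_derivative_iff_has_vector_derivative[symmetric]
      by (auto intro!: derivative_eq_intros simp: field_simps)
  qed
  also have "?P (x + b * h) - ?P (x + a * h) =
      h * (c0 * (b - a) + c1 * h * (b\<^sup>2 - a\<^sup>2) / 2 + c2 * h\<^sup>2 * (b ^ 3 - a ^ 3) / 6
      + c3 * h ^ 3 * (b ^ 4 - a ^ 4) / 24)"
    by (simp add: field_simps power2_eq_square power3_eq_cube power4_eq_xxxx)
  finally show ?thesis .
qed

text \<open>Successive derivatives as one sequence, the form in which Taylor's theorem takes them.
  It is instantiated by the iterated derivatives of u.\<close>

locale derivative_tower =
  fixes D :: "nat \<Rightarrow> real \<Rightarrow> real"
  assumes D_deriv: "\<And>k x. (D k has_real_derivative D (Suc k) x) (at x)"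
begin

lemma D_cont: "continuous_on S (D k)"
  by (rule DERIV_continuous_on) (rule has_field_derivative_at_within[OF D_deriv])

lemma D_bounded:
  obtains M where "0 \<le> M" "\<And>x. \<bar>x\<bar> \<le> A \<Longrightarrow> \<bar>D k x\<bar> \<le> M"
proof -
  have "compact (D k ` {-A..A})"
    by (intro compact_continuous_image D_cont) simp
  then have "\<exists>M. \<forall>y\<in>D k ` {-A..A}. \<bar>y\<bar> \<le> M"
    using compact_imp_bounded bounded_real by metis
  then obtain M where M: "\<And>x. x \<in> {-A..A} \<Longrightarrow> \<bar>D k x\<bar> \<le> M"
    by blast
  show thesis
  proof (rule that[of "\<bar>M\<bar>"])
    show "\<bar>D k x\<bar> \<le> \<bar>M\<bar>" if "\<bar>x\<bar> \<le> A" for x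
    proof -
      have "x \<in> {-A..A}"
        using that by auto
      from M[OF this] show ?thesis
        by linarith
    qed
  qed simp
qed

lemma grid_bigo_D: "grid_bigo 0 (\<lambda>h i. D k (grid h i))"
  unfolding grid_bigo_iff
proof
  fix A :: real
  obtain M where "0 \<le> M" "\<And>x. \<bar>x\<bar> \<le> A \<Longrightarrow> \<bar>D k x\<bar> \<le> M"
    using D_bounded by blast
  then show "\<exists>K\<ge>0. \<forall>\<^sub>F h in at_right 0. \<forall>i. \<bar>grid h i\<bar> \<le> A \<longrightarrow> \<bar>D k (grid h i)\<bar> \<le> K * h ^ 0"
    by (intro exI[of _ M]) auto
qed

text \<open>Mean value theorem on one cell width. This is the source of the extra order gained by
  every jump between neighbouring cells.\<close>

lemma grid_bigo_D_diff: "grid_bigo 1 (\<lambda>h i. D k (grid h i) - D k (grid h (i + 1)))"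
  unfolding grid_bigo_iff
proof
  fix A :: real
  obtain M where "0 \<le> M" and M: "\<And>x. \<bar>x\<bar> \<le> A + 1 \<Longrightarrow> \<bar>D (Suc k) x\<bar> \<le> M"
    using D_bounded by blast
  have "\<bar>D k (grid h i) - D k (grid h (i + 1))\<bar> \<le> M * h ^ 1"
    if "0 < h" "h < 1" "\<bar>grid h i\<bar> \<le> A" for h i
  proof -
    from that(1) obtain z where "grid h i < z" "z < grid h i + h"
      "D k (grid h i + h) - D k (grid h i) = h * D (Suc k) z"
      using MVT2[of "grid h i" "grid h i + h" "D k" "D (Suc k)"] D_deriv by auto
    moreover from this that have "\<bar>D (Suc k) z\<bar> \<le> M"
      by (intro M) linarith
    ultimately show ?thesis
      using \<open>0 < h\<close> by (simp add: grid_Suc abs_minus_commute[of "D k (grid h i)"] abs_mult mult.commute)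
  qed
  with \<open>0 \<le> M\<close> show "\<exists>K\<ge>0. \<forall>\<^sub>F h in at_right 0. \<forall>i. \<bar>grid h i\<bar> \<le> A \<longrightarrow>
      \<bar>D k (grid h i) - D k (grid h (i + 1))\<bar> \<le> K * h ^ 1"
    by (intro exI[of _ M] conjI eventually_at_right_0I[of 1]) auto
qed

text \<open>Lagrange form of the remainder; the factor 1/24 is dropped since only the order
  matters.\<close>

lemma taylor_remainder:
  assumes "\<And>z. \<bar>z\<bar> \<le> A \<Longrightarrow> \<bar>D 4 z\<bar> \<le> M" "\<bar>x\<bar> \<le> A" "\<bar>y\<bar> \<le> A"
  shows "\<bar>D 0 y - (D 0 x + D 1 x * (y - x) + 1 / 2 * D 2 x * (y - x)\<^sup>2 + 1 / 6 * D 3 x * (y - x) ^ 3)\<bar>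
    \<le> M * \<bar>y - x\<bar> ^ 4"
proof (cases "y = x")
  case False
  have "\<exists>t. (if y < x then y < t \<and> t < x else x < t \<and> t < y) \<and>
      D 0 y = (\<Sum>m<4. D m x / fact m * (y - x) ^ m) + D 4 t / fact 4 * (y - x) ^ 4"
    by (rule Taylor[of 4 D "D 0" "- A" A]) (use assms False D_deriv in auto)
  then obtain t where t: "if y < x then y < t \<and> t < x else x < t \<and> t < y"
    and eq: "D 0 y = (\<Sum>m<4. D m x / fact m * (y - x) ^ m) + D 4 t / fact 4 * (y - x) ^ 4"
    by blast
  from t assms(2,3) have "\<bar>t\<bar> \<le> A"
    by (auto split: if_splits)
  then have "\<bar>D 4 t / fact 4\<bar> \<le> M"
    using assms(1)[of t] by (simp add: fact_numeral)
  then have "\<bar>D 4 t / fact 4 * (y - x) ^ 4\<bar> \<le> M * \<bar>y - x\<bar> ^ 4"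
    unfolding abs_mult power_abs by (intro mult_right_mono) auto
  moreover have "(\<Sum>m<4. D m x / fact m * (y - x) ^ m) =
      D 0 x + D 1 x * (y - x) + 1 / 2 * D 2 x * (y - x)\<^sup>2 + 1 / 6 * D 3 x * (y - x) ^ 3"
    by (simp add: eval_nat_numeral fact_numeral)
  ultimately show ?thesis
    unfolding eq by simp
qed auto

text \<open>The Taylor polynomial is integrated exactly, and the remainder is bounded by its
  supremum times the length of the interval. General \<open>a\<close> and \<open>b\<close> cover
  both the neighbouring cells and the part-cells of \<open>Q\<close>.\<close>

lemma average_taylor:
  assumes "a \<le> b"
  shows "grid_bigo 4 (\<lambda>h i. (1 / h) * integral {grid h i + a * h .. grid h i + b * h} (D 0)
    - (D 0 (grid h i) * (b - a) + D 1 (grid h i) * h * (b\<^sup>2 - a\<^sup>2) / 2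
       + D 2 (grid h i) * h\<^sup>2 * (b ^ 3 - a ^ 3) / 6 + D 3 (grid h i) * h ^ 3 * (b ^ 4 - a ^ 4) / 24))"
  unfolding grid_bigo_iff
proof
  fix A :: real
  \<comment> \<open>The points of integration lie within c h of the grid point, hence within c, so
    the fourth derivative is bounded on the radius \<open>A + c\<close>.\<close>
  define c where "c = max \<bar>a\<bar> \<bar>b\<bar>"
  have "0 \<le> c"
    by (auto simp: c_def)
  obtain M where "0 \<le> M" and M: "\<And>z. \<bar>z\<bar> \<le> A + c \<Longrightarrow> \<bar>D 4 z\<bar> \<le> M"
    using D_bounded by blast
  have main: "\<bar>(1 / h) * integral {grid h i + a * h .. grid h i + b * h} (D 0)
    - (D 0 (grid h i) * (b - a) + D 1 (grid h i) * h * (b\<^sup>2 - a\<^sup>2) / 2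
       + D 2 (grid h i) * h\<^sup>2 * (b ^ 3 - a ^ 3) / 6 + D 3 (grid h i) * h ^ 3 * (b ^ 4 - a ^ 4) / 24)\<bar>
    \<le> (M * c ^ 4 * (b - a)) * h ^ 4"
    if h: "0 < h" "h < 1" and i: "\<bar>grid h i\<bar> \<le> A" for h i
  proof -
    define x where "x = grid h i"
    let ?T = "\<lambda>y. D 0 x + D 1 x * (y - x) + 1 / 2 * D 2 x * (y - x)\<^sup>2 + 1 / 6 * D 3 x * (y - x) ^ 3"
    let ?I = "D 0 x * (b - a) + D 1 x * h * (b\<^sup>2 - a\<^sup>2) / 2
       + D 2 x * h\<^sup>2 * (b ^ 3 - a ^ 3) / 6 + D 3 x * h ^ 3 * (b ^ 4 - a ^ 4) / 24"
    have ab: "a * h \<le> b * h"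
      using assms h by (simp add: mult_right_mono)
    have "(D 0 has_integral integral {x + a * h .. x + b * h} (D 0)) {x + a * h .. x + b * h}"
      by (intro integrable_integral integrable_continuous_interval D_cont)
    from has_integral_diff[OF this has_integral_cubic[OF h(1) assms]]
    have I: "((\<lambda>y. D 0 y - ?T y) has_integral integral {x + a * h .. x + b * h} (D 0) - h * ?I)
        {x + a * h .. x + b * h}" .
    have bound: "norm (D 0 y - ?T y) \<le> M * (c * h) ^ 4" if y: "y \<in> {x + a * h .. x + b * h}" for y
    proof -
      have "b * h \<le> c * h" "- (c * h) \<le> a * h"
        using mult_right_mono[of b c h] mult_right_mono[of "-c" a h] h by (auto simp: c_def)
      then have y1: "\<bar>y - x\<bar> \<le> c * h"
        using y by auto
      have "c * h \<le> c"
        using h \<open>0 \<le> c\<close> by (simp add: mult_left_le)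
      then have "\<bar>D 0 y - ?T y\<bar> \<le> M * \<bar>y - x\<bar> ^ 4"
        using i y1 \<open>0 \<le> c\<close> by (intro taylor_remainder[of "A + c"] M) (auto simp: x_def)
      also have "\<dots> \<le> M * (c * h) ^ 4"
        using y1 \<open>0 \<le> M\<close> by (intro mult_left_mono power_mono) auto
      finally show ?thesis
        by simp
    qed
    have "\<bar>integral {x + a * h .. x + b * h} (D 0) - h * ?I\<bar> \<le> M * (c * h) ^ 4 * (b * h - a * h)"
      using has_integral_bound_real[OF _ finite.emptyI I, of "M * (c * h) ^ 4"] bound ab \<open>0 \<le> M\<close> \<open>0 \<le> c\<close> h
      by auto
    also have "\<dots> = h * ((M * c ^ 4 * (b - a)) * h ^ 4)"
      by (simp add: algebra_simps)
    finally have "\<bar>integral {x + a * h .. x + b * h} (D 0) - h * ?I\<bar> / h \<le> (M * c ^ 4 * (b - a)) * h ^ 4"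
      using h by (simp add: divide_le_eq mult.commute)
    moreover have "\<bar>integral {x + a * h .. x + b * h} (D 0) - h * ?I\<bar> / h
        = \<bar>(1 / h) * integral {x + a * h .. x + b * h} (D 0) - ?I\<bar>"
    proof -
      have "\<bar>J - h * L\<bar> / h = \<bar>(1 / h) * J - L\<bar>" for J L :: real
        using h by (simp add: abs_if field_simps)
      then show ?thesis .
    qed
    ultimately show ?thesis
      unfolding x_def by (simp only:)
  qed
  show "\<exists>K\<ge>0. \<forall>\<^sub>F h in at_right 0. \<forall>i. \<bar>grid h i\<bar> \<le> A \<longrightarrow>
    \<bar>(1 / h) * integral {grid h i + a * h .. grid h i + b * h} (D 0)
    - (D 0 (grid h i) * (b - a) + D 1 (grid h i) * h * (b\<^sup>2 - a\<^sup>2) / 2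
       + D 2 (grid h i) * h\<^sup>2 * (b ^ 3 - a ^ 3) / 6 + D 3 (grid h i) * h ^ 3 * (b ^ 4 - a ^ 4) / 24)\<bar>
    \<le> K * h ^ 4"
    using \<open>0 \<le> M\<close> \<open>0 \<le> c\<close> assms
    by (intro exI[of _ "M * c ^ 4 * (b - a)"] conjI eventually_at_right_0I[of 1] allI impI main) auto
qed

lemma cell_avg_taylor:
  "grid_bigo 4 (\<lambda>h i. cell_avg (D 0) h (i + k)
    - (D 0 (grid h i) + D 1 (grid h i) * h * ((k + 1 / 2)\<^sup>2 - (k - 1 / 2)\<^sup>2) / 2
       + D 2 (grid h i) * h\<^sup>2 * ((k + 1 / 2) ^ 3 - (k - 1 / 2) ^ 3) / 6
       + D 3 (grid h i) * h ^ 3 * ((k + 1 / 2) ^ 4 - (k - 1 / 2) ^ 4) / 24))"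
proof (rule grid_bigo_cong[OF average_taylor[of "real_of_int k - 1 / 2" "real_of_int k + 1 / 2"]])
  fix h :: real and i
  have "grid h (i + k) - h / 2 = grid h i + (real_of_int k - 1 / 2) * h"
    "grid h (i + k) + h / 2 = grid h i + (real_of_int k + 1 / 2) * h"
    by (simp_all add: grid_def algebra_simps)
  then have "cell_avg (D 0) h (i + k) =
      (1 / h) * integral {grid h i + (real_of_int k - 1 / 2) * h .. grid h i + (real_of_int k + 1 / 2) * h} (D 0)"
    by (simp only: cell_avg_def sliding_avg_def)
  then show "cell_avg (D 0) h (i + k)
    - (D 0 (grid h i) + D 1 (grid h i) * h * ((k + 1 / 2)\<^sup>2 - (k - 1 / 2)\<^sup>2) / 2
       + D 2 (grid h i) * h\<^sup>2 * ((k + 1 / 2) ^ 3 - (k - 1 / 2) ^ 3) / 6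
       + D 3 (grid h i) * h ^ 3 * ((k + 1 / 2) ^ 4 - (k - 1 / 2) ^ 4) / 24) =
    (1 / h) * integral {grid h i + (real_of_int k - 1 / 2) * h .. grid h i + (real_of_int k + 1 / 2) * h} (D 0)
    - (D 0 (grid h i) * ((real_of_int k + 1 / 2) - (real_of_int k - 1 / 2))
       + D 1 (grid h i) * h * ((k + 1 / 2)\<^sup>2 - (k - 1 / 2)\<^sup>2) / 2
       + D 2 (grid h i) * h\<^sup>2 * ((k + 1 / 2) ^ 3 - (k - 1 / 2) ^ 3) / 6
       + D 3 (grid h i) * h ^ 3 * ((k + 1 / 2) ^ 4 - (k - 1 / 2) ^ 4) / 24)"
    by simp
qed simp

lemma cell_avg_mid:
  "grid_bigo 4 (\<lambda>h i. cell_avg (D 0) h i - (D 0 (grid h i) + h\<^sup>2 * D 2 (grid h i) / 24))"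
  by (rule grid_bigo_cong[OF cell_avg_taylor[of 0]]) (simp add: power_divide)

text \<open>The constants are moments of the neighbouring cell: 13/24 = ((3/2)^3 - (1/2)^3) / 6 and
  5/24 = ((3/2)^4 - (1/2)^4) / 24.\<close>

lemma cell_avg_next:
  "grid_bigo 4 (\<lambda>h i. cell_avg (D 0) h (i + 1)
    - (D 0 (grid h i) + h * D 1 (grid h i) + 13 / 24 * h\<^sup>2 * D 2 (grid h i) + 5 / 24 * h ^ 3 * D 3 (grid h i)))"
  by (rule grid_bigo_cong[OF cell_avg_taylor[of 1]]) (simp add: power_divide mult_ac)

lemma cell_avg_prev:
  "grid_bigo 4 (\<lambda>h i. cell_avg (D 0) h (i - 1)
    - (D 0 (grid h i) - h * D 1 (grid h i) + 13 / 24 * h\<^sup>2 * D 2 (grid h i) - 5 / 24 * h ^ 3 * D 3 (grid h i)))"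
  by (rule grid_bigo_cong[OF cell_avg_taylor[of "-1"]]) (simp add: power_divide mult_ac)

section \<open>Expansions of lateral slopes and second differences\<close>

definition slopeL :: "real \<Rightarrow> int \<Rightarrow> real" where
  "slopeL h i = (cell_avg (D 0) h i - cell_avg (D 0) h (i - 1)) / h"

definition slopeR :: "real \<Rightarrow> int \<Rightarrow> real" where
  "slopeR h i = (cell_avg (D 0) h (i + 1) - cell_avg (D 0) h i) / h"

text \<open>The term in \<open>D 3\<close> is kept explicitly: it is the same in both lateral slopes
  and so survives in their mean, but its jump between cells is of third order.\<close>

lemma slopeR_expand3:
  "grid_bigo 3 (\<lambda>h i. slopeR h i
    - (D 1 (grid h i) + h * D 2 (grid h i) / 2 + 5 / 24 * h\<^sup>2 * D 3 (grid h i)))"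
proof (rule grid_bigo_cong)
  show "grid_bigo 3 (\<lambda>h i. ((cell_avg (D 0) h (i + 1)
    - (D 0 (grid h i) + h * D 1 (grid h i) + 13 / 24 * h\<^sup>2 * D 2 (grid h i) + 5 / 24 * h ^ 3 * D 3 (grid h i)))
    - (cell_avg (D 0) h i - (D 0 (grid h i) + h\<^sup>2 * D 2 (grid h i) / 24))) / h)"
    by (rule grid_bigo_divide_h) (use grid_bigo_diff[OF cell_avg_next cell_avg_mid] in simp)
qed (simp add: slopeR_def field_simps power2_eq_square power3_eq_cube)

lemma slopeL_expand3:
  "grid_bigo 3 (\<lambda>h i. slopeL h i
    - (D 1 (grid h i) - h * D 2 (grid h i) / 2 + 5 / 24 * h\<^sup>2 * D 3 (grid h i)))"
proof (rule grid_bigo_cong)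
  show "grid_bigo 3 (\<lambda>h i. ((cell_avg (D 0) h i - (D 0 (grid h i) + h\<^sup>2 * D 2 (grid h i) / 24))
    - (cell_avg (D 0) h (i - 1)
    - (D 0 (grid h i) - h * D 1 (grid h i) + 13 / 24 * h\<^sup>2 * D 2 (grid h i) - 5 / 24 * h ^ 3 * D 3 (grid h i)))) / h)"
    by (rule grid_bigo_divide_h) (use grid_bigo_diff[OF cell_avg_mid cell_avg_prev] in simp)
qed (simp add: slopeL_def field_simps power2_eq_square power3_eq_cube)

text \<open>The odd derivatives cancel by symmetry, and the factors of h^2 u'' add up to 13/24 +
  13/24 - 2/24 = 1.\<close>

lemma second_difference:
  "grid_bigo 4 (\<lambda>h i. cell_avg (D 0) h (i + 1) - 2 * cell_avg (D 0) h i + cell_avg (D 0) h (i - 1)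
    - h\<^sup>2 * D 2 (grid h i))"
  by (rule grid_bigo_cong[OF grid_bigo_add[OF cell_avg_next
        grid_bigo_diff[OF cell_avg_prev grid_bigo_cmult[OF cell_avg_mid, of 2]]]]) (simp add: algebra_simps)

lemma slopeR_expand2: "grid_bigo 2 (\<lambda>h i. slopeR h i - (D 1 (grid h i) + h * D 2 (grid h i) / 2))"
  by (rule grid_bigo_cong[OF grid_bigo_add[OF grid_bigo_mono[OF slopeR_expand3, of 2]
        grid_bigo_power_mult[OF grid_bigo_cmult[OF grid_bigo_D[of 3], of "5 / 24"], of 2 2]]]) auto

lemma slopeL_expand2: "grid_bigo 2 (\<lambda>h i. slopeL h i - (D 1 (grid h i) - h * D 2 (grid h i) / 2))"
  by (rule grid_bigo_cong[OF grid_bigo_add[OF grid_bigo_mono[OF slopeL_expand3, of 2]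
        grid_bigo_power_mult[OF grid_bigo_cmult[OF grid_bigo_D[of 3], of "5 / 24"], of 2 2]]]) auto

section \<open>Coefficients for weights close to the linear ones\<close>

text \<open>With central weight 1/2, \<open>coeff0\<close> subtracts 1/24 of the second difference,
  which to order four is the excess of a cell average over the midpoint value; a deviation of the
  weight by O(h^2) multiplies a second difference of order h^2. In \<open>coeff1\<close>,
  eliminating the central weight leaves the mean of the lateral slopes plus half the lateral weight
  difference times the gap between these slopes.\<close>

lemma coefficients_accuracy:
  fixes w :: "real \<Rightarrow> stencil \<Rightarrow> int \<Rightarrow> real"
  assumes wC: "grid_bigo 2 (\<lambda>h i. w h SC i - 1 / 2)"
    and w_sum: "\<forall>\<^sub>F h in at_right 0. \<forall>i. w h SL i + w h SC i + w h SR i = 1"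
    and w_diff: "grid_bigo 1 (\<lambda>h i. w h SR i - w h SL i)"
    and w_jump: "grid_bigo 2 (\<lambda>h i. (w h SR i - w h SL i) - (w h SR (i + 1) - w h SL (i + 1)))"
  shows "grid_bigo 4 (\<lambda>h i. D 0 (grid h i) - coeff0 (w h) (cell_avg (D 0) h) i)"
    and "grid_bigo 3 (\<lambda>h i. (D 1 (grid h i) - D 1 (grid h (i + 1)))
      - (coeff1 (w h) h (cell_avg (D 0) h) i - coeff1 (w h) h (cell_avg (D 0) h) (i + 1)))"
    and "grid_bigo 2 (\<lambda>h i. D 2 (grid h i) - coeff2 (w h) h (cell_avg (D 0) h) i)"
proof -
  let ?v = "cell_avg (D 0)"
  let ?d2 = "\<lambda>h i. ?v h (i + 1) - 2 * ?v h i + ?v h (i - 1)"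
  have d2: "grid_bigo 2 ?d2"
    by (rule grid_bigo_cong[OF grid_bigo_add[OF grid_bigo_mono[OF second_difference, of 2]
        grid_bigo_power_mult[OF grid_bigo_D[of 2], of 2 2]]]) auto
  have prod: "grid_bigo 4 (\<lambda>h i. (w h SC i - 1 / 2) * ?d2 h i)"
    by (rule grid_bigo_mult[OF wC d2]) simp
  show "grid_bigo 4 (\<lambda>h i. D 0 (grid h i) - coeff0 (w h) (?v h) i)"
    by (rule grid_bigo_cong[OF grid_bigo_diff[OF grid_bigo_add[OF
          grid_bigo_cmult[OF prod, of "1 / 12"] grid_bigo_cmult[OF second_difference, of "1 / 24"]]
          cell_avg_mid]])
      (simp add: coeff0_def algebra_simps)
  have "grid_bigo 4 (\<lambda>h i. 2 * ((w h SC i - 1 / 2) * ?d2 h i) + (?d2 h i - h\<^sup>2 * D 2 (grid h i)))"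
    by (intro grid_bigo_add grid_bigo_cmult prod second_difference)
  then have "grid_bigo 2 (\<lambda>h i. (2 * ((w h SC i - 1 / 2) * ?d2 h i) + (?d2 h i - h\<^sup>2 * D 2 (grid h i))) / h / h)"
    by (intro grid_bigo_divide_h) (simp add: numeral_eq_Suc)
  from grid_bigo_cmult[OF this, of "- 1"]
  show "grid_bigo 2 (\<lambda>h i. D 2 (grid h i) - coeff2 (w h) h (?v h) i)"
    by (rule grid_bigo_cong) (simp add: coeff2_def field_simps power2_eq_square)

  let ?cd = "\<lambda>h i. (slopeL h i + slopeR h i) / 2"
  let ?dw = "\<lambda>h i. w h SR i - w h SL i"
  \<comment> \<open>A genuine second-order error of the central slope. It is carried along
    explicitly, since only its jump is of third order.\<close>
  have cd: "grid_bigo 3 (\<lambda>h i. D 1 (grid h i) - ?cd h i + 5 / 24 * h\<^sup>2 * D 3 (grid h i))"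
    by (rule grid_bigo_cong[OF grid_bigo_cmult[OF grid_bigo_add[OF slopeL_expand3 slopeR_expand3], of "- 1 / 2"]])
      (simp add: field_simps)
  have "grid_bigo 3 (\<lambda>h i. h\<^sup>2 * (D 3 (grid h i) - D 3 (grid h (i + 1))))"
    by (rule grid_bigo_power_mult[OF grid_bigo_D_diff]) simp
  from grid_bigo_diff[OF grid_bigo_diff[OF cd grid_bigo_shift[OF cd]] grid_bigo_cmult[OF this, of "5 / 24"]]
  have central: "grid_bigo 3 (\<lambda>h i. (D 1 (grid h i) - D 1 (grid h (i + 1))) - (?cd h i - ?cd h (i + 1)))"
    by (rule grid_bigo_cong) (simp add: algebra_simps)
  have gap: "grid_bigo 1 (\<lambda>h i. ?d2 h i / h)"
    using d2 by (intro grid_bigo_divide_h) (simp add: numeral_eq_Suc)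
  have r: "grid_bigo 3 (\<lambda>h i. (?d2 h i - h\<^sup>2 * D 2 (grid h i)) / h)"
    using second_difference by (intro grid_bigo_divide_h) (simp add: numeral_eq_Suc)
  \<comment> \<open>As \<open>?d2 / h\<close> equals h u'' up to third order, its jump has the
    factor h and one more order from the variation of u''.\<close>
  have "grid_bigo 2 (\<lambda>h i. h ^ 1 * (D 2 (grid h i) - D 2 (grid h (i + 1))))"
    by (rule grid_bigo_power_mult[OF grid_bigo_D_diff]) simp
  from grid_bigo_add[OF grid_bigo_mono[OF grid_bigo_diff[OF r grid_bigo_shift[OF r]]] this]
  have gap_jump: "grid_bigo 2 (\<lambda>h i. ?d2 h i / h - ?d2 h (i + 1) / h)"
    by (rule grid_bigo_cong) (auto simp: field_simps power2_eq_square)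
  \<comment> \<open>Discrete product rule for the jump of \<open>?dw * (?d2 / h)\<close>; the orders
    of the factors are 2 + 1 and 1 + 2.\<close>
  have "grid_bigo 3 (\<lambda>h i. (?dw h i - ?dw h (i + 1)) * (?d2 h i / h)
      + ?dw h (i + 1) * (?d2 h i / h - ?d2 h (i + 1) / h))"
    by (intro grid_bigo_add grid_bigo_mult[OF w_jump gap]
        grid_bigo_mult[OF grid_bigo_shift[OF w_diff] gap_jump]) auto
  from grid_bigo_diff[OF central grid_bigo_cmult[OF this, of "1 / 2"]]
  show "grid_bigo 3 (\<lambda>h i. (D 1 (grid h i) - D 1 (grid h (i + 1)))
      - (coeff1 (w h) h (?v h) i - coeff1 (w h) h (?v h) (i + 1)))"
  proof (rule grid_bigo_cong_ev)
    have c1: "coeff1 (w h) h (?v h) i = ?cd h i + 1 / 2 * (?dw h i * (?d2 h i / h))"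
      if "w h SL i + w h SC i + w h SR i = 1" for h i
    proof -
      have wC: "w h SC i = 1 - w h SL i - w h SR i"
        using that by simp
      show ?thesis
        unfolding coeff1_def wC slopeL_def slopeR_def
        by (cases "h = 0") (simp_all add: field_simps)
    qed
    show "\<forall>\<^sub>F h in at_right 0. \<forall>i. (D 1 (grid h i) - D 1 (grid h (i + 1)))
      - (coeff1 (w h) h (?v h) i - coeff1 (w h) h (?v h) (i + 1)) =
      (D 1 (grid h i) - D 1 (grid h (i + 1))) - (?cd h i - ?cd h (i + 1))
      - 1 / 2 * ((?dw h i - ?dw h (i + 1)) * (?d2 h i / h)
        + ?dw h (i + 1) * (?d2 h i / h - ?d2 h (i + 1) / h))"
      using w_sum
    proof eventually_elim
      case (elim h)
      show ?case
      proof
        fix i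
        have c: "coeff1 (w h) h (?v h) i = ?cd h i + 1 / 2 * (?dw h i * (?d2 h i / h))"
          "coeff1 (w h) h (?v h) (i + 1) = ?cd h (i + 1) + 1 / 2 * (?dw h (i + 1) * (?d2 h (i + 1) / h))"
          by (rule c1, use elim in blast)+
        have "1 / 2 * (a * p) - 1 / 2 * (b * q) = 1 / 2 * ((a - b) * p + b * (p - q))" for a b p q :: real
          by algebra
        from this[of "?dw h i" "?d2 h i / h" "?dw h (i + 1)" "?d2 h (i + 1) / h"]
        show "(D 1 (grid h i) - D 1 (grid h (i + 1)))
          - (coeff1 (w h) h (?v h) i - coeff1 (w h) h (?v h) (i + 1)) =
          (D 1 (grid h i) - D 1 (grid h (i + 1))) - (?cd h i - ?cd h (i + 1))
          - 1 / 2 * ((?dw h i - ?dw h (i + 1)) * (?d2 h i / h)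
            + ?dw h (i + 1) * (?d2 h i / h - ?d2 h (i + 1) / h))"
          unfolding c by linarith
      qed
    qed
  qed
qed

section \<open>Accuracy of the shifted averages\<close>

lemma reconstruction_accuracy:
  fixes r0 r1 r2 :: "real \<Rightarrow> int \<Rightarrow> real"
  assumes e0: "grid_bigo 4 (\<lambda>h i. D 0 (grid h i) - r0 h i)"
    and e1: "grid_bigo 3 (\<lambda>h i. (D 1 (grid h i) - D 1 (grid h (i + 1))) - (r1 h i - r1 h (i + 1)))"
    and e2: "grid_bigo 2 (\<lambda>h i. D 2 (grid h i) - r2 h i)"
    and \<theta>: "0 \<le> \<theta>" "\<theta> \<le> 1"
  defines "P \<equiv> \<lambda>h i x. r0 h i + r1 h i * (x - grid h i) + 1 / 2 * r2 h i * (x - grid h i)\<^sup>2"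
  shows "grid_bigo 4 (\<lambda>h i.
    (1 / h) * integral {grid h i - h / 2 + \<theta> * h .. grid h i + h / 2} (P h i)
    + (1 / h) * integral {grid h i + h / 2 .. grid h i + h / 2 + \<theta> * h} (P h (i + 1))
    - sliding_avg (D 0) h (grid h i + \<theta> * h))"
proof -
  \<comment> \<open>In coordinates centred at the respective cell and scaled by h, the part-cells
    are [a, 1/2] in cell i and [-1/2, a] in cell i + 1.\<close>
  define a where "a = \<theta> - 1 / 2"
  have a: "- (1 / 2) \<le> a" "a \<le> 1 / 2"
    using \<theta> by (auto simp: a_def)
  \<comment> \<open>\<open>T\<close>, \<open>S\<close> and \<open>I\<close> are the contributions of
    the Taylor polynomial of u, of the reconstruction and of u itself. The error is split as (S - T)
    + (T - I), summed over both part-cells.\<close>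
  define T where "T h i l r = D 0 (grid h i) * (r - l) + D 1 (grid h i) * h * (r\<^sup>2 - l\<^sup>2) / 2
       + D 2 (grid h i) * h\<^sup>2 * (r ^ 3 - l ^ 3) / 6 + D 3 (grid h i) * h ^ 3 * (r ^ 4 - l ^ 4) / 24"
    for h i and l r :: real
  define S where "S h i l r = r0 h i * (r - l) + r1 h i * h * (r\<^sup>2 - l\<^sup>2) / 2
       + r2 h i * h\<^sup>2 * (r ^ 3 - l ^ 3) / 6" for h i and l r :: real
  define I where "I h i l r = (1 / h) * integral {grid h i + l * h .. grid h i + r * h} (D 0)"
    for h i and l r :: real
  have int_P: "(1 / h) * integral {grid h i + l * h .. grid h i + r * h} (P h i) = S h i l r"
    if "0 < h" "l \<le> r" for h i l r
  proof -
    from has_integral_cubic[OF that, of "r0 h i" "r1 h i" "grid h i" "r2 h i" 0]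
    have "(P h i has_integral h * S h i l r) {grid h i + l * h .. grid h i + r * h}"
      by (simp add: P_def S_def)
    then have "integral {grid h i + l * h .. grid h i + r * h} (P h i) = h * S h i l r"
      by (rule integral_unique)
    with that show ?thesis
      by simp
  qed
  have t1: "grid_bigo 4 (\<lambda>h i. I h i a (1 / 2) - T h i a (1 / 2))"
    unfolding I_def T_def by (rule average_taylor[OF a(2)])
  have t2: "grid_bigo 4 (\<lambda>h i. I h (i + 1) (- 1 / 2) a - T h (i + 1) (- 1 / 2) a)"
    unfolding I_def T_def by (rule grid_bigo_shift[OF average_taylor]) (use a in simp)
  have u1: "grid_bigo 4 (\<lambda>h i. h ^ 1 * ((D 1 (grid h i) - D 1 (grid h (i + 1))) - (r1 h i - r1 h (i + 1))))"
    by (rule grid_bigo_power_mult[OF e1]) simp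
  have u2: "grid_bigo 4 (\<lambda>h i. h\<^sup>2 * (D 2 (grid h i) - r2 h i))"
    by (rule grid_bigo_power_mult[OF e2]) simp
  have u3: "grid_bigo 4 (\<lambda>h i. h ^ 3 * (D 3 (grid h i) - D 3 (grid h (i + 1))))"
    by (rule grid_bigo_power_mult[OF grid_bigo_D_diff]) simp
  \<comment> \<open>The moments of odd order of the two cells are opposite, so that the errors in the odd
    derivatives enter only through their jumps from one cell to the next.\<close>
  have "grid_bigo 4 (\<lambda>h i.
      (1 / 2 - a) * (D 0 (grid h i) - r0 h i) + (1 / 2 + a) * (D 0 (grid h (i + 1)) - r0 h (i + 1))
      + (1 / 4 - a\<^sup>2) / 2
        * (h ^ 1 * ((D 1 (grid h i) - D 1 (grid h (i + 1))) - (r1 h i - r1 h (i + 1))))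
      + (1 / 8 - a ^ 3) / 6 * (h\<^sup>2 * (D 2 (grid h i) - r2 h i))
      + (1 / 8 + a ^ 3) / 6 * (h\<^sup>2 * (D 2 (grid h (i + 1)) - r2 h (i + 1)))
      + (1 / 16 - a ^ 4) / 24 * (h ^ 3 * (D 3 (grid h i) - D 3 (grid h (i + 1)))))"
    by (intro grid_bigo_add grid_bigo_cmult e0 grid_bigo_shift[OF e0] u1 u2 u3 grid_bigo_shift[OF u2])
  then have ST: "grid_bigo 4 (\<lambda>h i. T h i a (1 / 2) + T h (i + 1) (- 1 / 2) a
      - (S h i a (1 / 2) + S h (i + 1) (- 1 / 2) a))"
    by (rule grid_bigo_cong) (simp add: T_def S_def power_divide field_simps)
  show ?thesis
  proof (rule grid_bigo_cong[OF grid_bigo_cmult[OF grid_bigo_add[OF ST grid_bigo_add[OF t1 t2]], of "- 1"]])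
    fix h :: real and i
    assume h: "0 < h"
    \<comment> \<open>The interface between the two cells needs two descriptions, one from each
      centre.\<close>
    have e: "grid h i - h / 2 + \<theta> * h = grid h i + a * h"
      "grid h i + h / 2 = grid h i + 1 / 2 * h"
      "grid h i + h / 2 = grid h (i + 1) + (- 1 / 2) * h"
      "grid h i + h / 2 + \<theta> * h = grid h (i + 1) + a * h"
      "grid h i + \<theta> * h - h / 2 = grid h i + a * h"
      "grid h i + \<theta> * h + h / 2 = grid h (i + 1) + a * h"
      by (simp_all add: a_def grid_def field_simps)
    have "integral {grid h i + a * h .. grid h i + h / 2} (D 0)
        + integral {grid h i + h / 2 .. grid h (i + 1) + a * h} (D 0)
        = integral {grid h i + a * h .. grid h (i + 1) + a * h} (D 0)"
    proof (rule Henstock_Kurzweil_Integration.integral_combine)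
      show "grid h i + a * h \<le> grid h i + h / 2"
        using mult_right_mono[OF a(2), of h] h by simp
      show "grid h i + h / 2 \<le> grid h (i + 1) + a * h"
        using mult_right_mono[OF a(1), of h] h by (simp add: grid_Suc)
      show "D 0 integrable_on {grid h i + a * h .. grid h (i + 1) + a * h}"
        by (intro integrable_continuous_interval D_cont)
    qed
    moreover have "I h i a (1 / 2) = (1 / h) * integral {grid h i + a * h .. grid h i + h / 2} (D 0)"
      unfolding I_def e(2) ..
    moreover have "I h (i + 1) (- 1 / 2) a =
        (1 / h) * integral {grid h i + h / 2 .. grid h (i + 1) + a * h} (D 0)"
      unfolding I_def e(3) ..
    ultimately have "sliding_avg (D 0) h (grid h i + \<theta> * h) = I h i a (1 / 2) + I h (i + 1) (- 1 / 2) a"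
      unfolding sliding_avg_def e(5,6) by (metis distrib_left)
    moreover have "(1 / h) * integral {grid h i - h / 2 + \<theta> * h .. grid h i + h / 2} (P h i) = S h i a (1 / 2)"
      unfolding e(1,2) by (rule int_P[OF h a(2)])
    moreover have "(1 / h) * integral {grid h i + h / 2 .. grid h i + h / 2 + \<theta> * h} (P h (i + 1))
        = S h (i + 1) (- 1 / 2) a"
      \<comment> \<open>The right endpoint is rewritten first, because its expression contains that
        of the left one.\<close>
      unfolding e(4) unfolding e(3) by (rule int_P[OF h]) (use a in simp)
    ultimately show "(1 / h) * integral {grid h i - h / 2 + \<theta> * h .. grid h i + h / 2} (P h i)
      + (1 / h) * integral {grid h i + h / 2 .. grid h i + h / 2 + \<theta> * h} (P h (i + 1))
      - sliding_avg (D 0) h (grid h i + \<theta> * h) =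
      - 1 * (T h i a (1 / 2) + T h (i + 1) (- 1 / 2) a - (S h i a (1 / 2) + S h (i + 1) (- 1 / 2) a)
      + ((I h i a (1 / 2) - T h i a (1 / 2)) + (I h (i + 1) (- 1 / 2) a - T h (i + 1) (- 1 / 2) a)))"
      by simp
  qed
qed

end

section \<open>The nonlinear weights\<close>

lemma smoothness_nonneg: "0 \<le> smoothness v m i"
  by (cases m) auto

lemma raw_weight_nonneg: "0 \<le> raw_weight s e v m i"
  by (cases s; cases m) auto

lemma raw_weight_pos:
  assumes "0 < e"
  shows "0 < raw_weight s e v m i"
proof -
  have "0 < e + smoothness v m i"
    using assms smoothness_nonneg[of v m i] by linarith
  moreover from this have "0 \<le> tau v i / (e + smoothness v m i)"
    by (simp add: tau_def)
  then have "0 < 1 + tau v i / (e + smoothness v m i)"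
    by linarith
  moreover have "0 < lin_weight m"
    by (cases m) auto
  ultimately show ?thesis
    by (cases s) auto
qed

text \<open>The factor 2 is the quotient of the central by a lateral linear weight, so that exactly
  linear weights give the value 1 on either side.\<close>

definition rel_weight :: "scheme \<Rightarrow> real \<Rightarrow> (int \<Rightarrow> real) \<Rightarrow> stencil \<Rightarrow> int \<Rightarrow> real" where
  "rel_weight s e v m i = 2 * raw_weight s e v m i / raw_weight s e v SC i"

lemma rel_weight_nonneg: "0 \<le> rel_weight s e v m i"
  by (simp add: rel_weight_def raw_weight_nonneg)

text \<open>Dividing by the central raw weight turns the normalising sum into a quantity that is at
  least 1, as required by \<open>grid_bigo_divide\<close>.\<close>

lemma weight_rel:
  assumes "0 < e"
  shows "weight s e v SC i = 1 / (1 + (rel_weight s e v SL i + rel_weight s e v SR i) / 2)"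
    and "weight s e v SL i =
      rel_weight s e v SL i / 2 / (1 + (rel_weight s e v SL i + rel_weight s e v SR i) / 2)"
    and "weight s e v SR i =
      rel_weight s e v SR i / 2 / (1 + (rel_weight s e v SL i + rel_weight s e v SR i) / 2)"
  using raw_weight_pos[OF assms(1), of s v SL i] raw_weight_pos[OF assms(1), of s v SC i]
    raw_weight_pos[OF assms(1), of s v SR i]
  by (auto simp: weight_def rel_weight_def field_simps)

text \<open>The terms \<open>h F\<close> cancel in the central weight; the difference of the lateral weights is only
  of order \<open>h\<close>, but its jump between neighbouring cells gains one order since \<open>F\<close> is Lipschitz.\<close>

lemma weights_near_linear:
  fixes v :: "real \<Rightarrow> int \<Rightarrow> real" and F :: "real \<Rightarrow> int \<Rightarrow> real"
  assumes eps: "\<forall>\<^sub>F h in at_right 0. 0 < eps h"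
    and L: "grid_bigo 2 (\<lambda>h i. rel_weight s (eps h) (v h) SL i - 1 - h * F h i)"
    and R: "grid_bigo 2 (\<lambda>h i. rel_weight s (eps h) (v h) SR i - 1 + h * F h i)"
    and F: "grid_bigo 0 F" "grid_bigo 1 (\<lambda>h i. F h i - F h (i + 1))"
  defines "w \<equiv> \<lambda>h. weight s (eps h) (v h)"
  shows "grid_bigo 2 (\<lambda>h i. w h SC i - 1 / 2)"
    and "\<forall>\<^sub>F h in at_right 0. \<forall>i. w h SL i + w h SC i + w h SR i = 1"
    and "grid_bigo 1 (\<lambda>h i. w h SR i - w h SL i)"
    and "grid_bigo 2 (\<lambda>h i. (w h SR i - w h SL i) - (w h SR (i + 1) - w h SL (i + 1)))"
proof -
  let ?L = "\<lambda>h i. rel_weight s (eps h) (v h) SL i"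
  let ?R = "\<lambda>h i. rel_weight s (eps h) (v h) SR i"
  let ?rL = "\<lambda>h i. ?L h i - 1 - h * F h i"
  let ?rR = "\<lambda>h i. ?R h i - 1 + h * F h i"
  let ?d = "\<lambda>h i. 1 + (?L h i + ?R h i) / 2"
  have d: "1 \<le> ?d h i" for h i
    using rel_weight_nonneg[of s "eps h" "v h" SL i] rel_weight_nonneg[of s "eps h" "v h" SR i] by simp
  have d0: "?d h i \<noteq> 0" for h i
    using d[of h i] by linarith
  show "\<forall>\<^sub>F h in at_right 0. \<forall>i. w h SL i + w h SC i + w h SR i = 1"
    using eps
  proof eventually_elim
    case (elim h)
    have total: "l / 2 / d + 1 / d + r / 2 / d = 1" if "d = 1 + (l + r) / 2" "d \<noteq> 0" for d l r :: real
      using that(2) by (simp add: field_simps) (simp add: that(1))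
    show ?case
      unfolding w_def weight_rel[OF elim] by (intro allI total refl d0)
  qed
  \<comment> \<open>Here 1/d - 1/2 = (2 - L - R) / (4 d), and in L + R - 2 the terms with F
    cancel.\<close>
  have "grid_bigo 2 (\<lambda>h i. - (1 / 4) * (?rL h i + ?rR h i) / ?d h i)"
    by (intro grid_bigo_divide grid_bigo_cmult grid_bigo_add L R always_eventually allI d)
  then show "grid_bigo 2 (\<lambda>h i. w h SC i - 1 / 2)"
  proof (rule grid_bigo_cong_ev)
    show "\<forall>\<^sub>F h in at_right 0. \<forall>i. w h SC i - 1 / 2 = - (1 / 4) * (?rL h i + ?rR h i) / ?d h i"
      using eps
    proof eventually_elim
      case (elim h)
      show ?case
        unfolding w_def weight_rel[OF elim] using d0[of h] by (auto simp: divide_simps) (simp add: algebra_simps)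
    qed
  qed
  have hF: "grid_bigo 1 (\<lambda>h i. h ^ 1 * F h i)"
    by (rule grid_bigo_power_mult[OF F(1)]) simp
  have "grid_bigo 2 (\<lambda>h i. (h ^ 1 * F h i) * (?rL h i + ?rR h i))"
    by (rule grid_bigo_mult[OF hF grid_bigo_add[OF L R]]) simp
  \<comment> \<open>The leading part of the lateral difference is - h F / 2. Adding its negative
    over the common denominator \<open>?d\<close>, which equals 2 + (rL + rR) / 2, removes h F and
    leaves these terms.\<close>
  then have "grid_bigo 2 (\<lambda>h i. (1 / 2 * (?rR h i - ?rL h i)
      + 1 / 4 * ((h ^ 1 * F h i) * (?rL h i + ?rR h i))) / ?d h i)"
    by (intro grid_bigo_divide grid_bigo_add[of 2] grid_bigo_cmult grid_bigo_diff[of 2] L R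
        always_eventually allI d)
  then have D: "grid_bigo 2 (\<lambda>h i. (w h SR i - w h SL i) + 1 / 2 * (h ^ 1 * F h i))"
  proof (rule grid_bigo_cong_ev)
    show "\<forall>\<^sub>F h in at_right 0. \<forall>i. (w h SR i - w h SL i) + 1 / 2 * (h ^ 1 * F h i)
      = (1 / 2 * (?rR h i - ?rL h i) + 1 / 4 * ((h ^ 1 * F h i) * (?rL h i + ?rR h i))) / ?d h i"
      using eps
    proof eventually_elim
      case (elim h)
      show ?case
        unfolding w_def weight_rel[OF elim] using d0[of h] by (auto simp: divide_simps) (simp add: algebra_simps)
    qed
  qed
  show "grid_bigo 1 (\<lambda>h i. w h SR i - w h SL i)"
    by (rule grid_bigo_cong[OF grid_bigo_diff[OF grid_bigo_mono[OF D, of 1]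
          grid_bigo_cmult[OF hF, of "1 / 2"]]]) auto
  have "grid_bigo 2 (\<lambda>h i. h ^ 1 * (F h i - F h (i + 1)))"
    by (rule grid_bigo_power_mult[OF F(2)]) simp
  from grid_bigo_diff[OF grid_bigo_diff[OF D grid_bigo_shift[OF D]] grid_bigo_cmult[OF this, of "1 / 2"]]
  show "grid_bigo 2 (\<lambda>h i. (w h SR i - w h SL i) - (w h SR (i + 1) - w h SL (i + 1)))"
    by (rule grid_bigo_cong) (simp add: algebra_simps)
qed

section \<open>Smoothness indicators on the scale h^2\<close>

context derivative_tower
begin

lemma slopeL_near: "grid_bigo 1 (\<lambda>h i. slopeL h i - D 1 (grid h i))"
  by (rule grid_bigo_cong[OF grid_bigo_diff[OF grid_bigo_mono[OF slopeL_expand2, of 1]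
        grid_bigo_power_mult[OF grid_bigo_cmult[OF grid_bigo_D[of 2], of "1 / 2"], of 1 1]]]) auto

lemma slopeR_near: "grid_bigo 1 (\<lambda>h i. slopeR h i - D 1 (grid h i))"
  by (rule grid_bigo_cong[OF grid_bigo_add[OF grid_bigo_mono[OF slopeR_expand2, of 1]
        grid_bigo_power_mult[OF grid_bigo_cmult[OF grid_bigo_D[of 2], of "1 / 2"], of 1 1]]]) auto

lemma slopeL_bounded: "grid_bigo 0 slopeL"
  using grid_bigo_add[OF grid_bigo_mono[OF slopeL_near, of 0] grid_bigo_D[of 1]] by simp

lemma slopeR_bounded: "grid_bigo 0 slopeR"
  using grid_bigo_add[OF grid_bigo_mono[OF slopeR_near, of 0] grid_bigo_D[of 1]] by simp

lemma slope_gap: "grid_bigo 2 (\<lambda>h i. slopeR h i - slopeL h i - h * D 2 (grid h i))"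
  by (rule grid_bigo_cong[OF grid_bigo_diff[OF slopeR_expand2 slopeL_expand2]]) (simp add: field_simps)

lemma slope_gap_bound: "grid_bigo 1 (\<lambda>h i. slopeR h i - slopeL h i)"
  using grid_bigo_diff[OF slopeR_near slopeL_near] by simp

definition scaled_smoothness :: "stencil \<Rightarrow> real \<Rightarrow> int \<Rightarrow> real" where
  "scaled_smoothness m h i = smoothness (cell_avg (D 0) h) m i / h\<^sup>2"

lemma scaled_smoothness_nonneg: "0 \<le> scaled_smoothness m h i"
  by (simp add: scaled_smoothness_def smoothness_nonneg)

lemma scaled_smoothness_eq:
  assumes "0 < h"
  shows "scaled_smoothness SL h i = (slopeL h i)\<^sup>2"
    and "scaled_smoothness SR h i = (slopeR h i)\<^sup>2"
    and "scaled_smoothness SC h i =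
      13 / 3 * (slopeR h i - slopeL h i)\<^sup>2 + 1 / 4 * (slopeR h i + slopeL h i)\<^sup>2"
  using assms
  by (simp_all add: scaled_smoothness_def slopeL_def slopeR_def power_divide
      diff_divide_distrib[symmetric] add_divide_distrib[symmetric] algebra_simps)
    (simp add: add_divide_distrib)

lemma scaled_smoothness_near:
  shows "grid_bigo 1 (\<lambda>h i. scaled_smoothness SL h i - (D 1 (grid h i))\<^sup>2)"
    and "grid_bigo 1 (\<lambda>h i. scaled_smoothness SR h i - (D 1 (grid h i))\<^sup>2)"
proof -
  have "grid_bigo 1 (\<lambda>h i. (slopeL h i - D 1 (grid h i)) * (slopeL h i + D 1 (grid h i)))"
    by (rule grid_bigo_mult[OF slopeL_near grid_bigo_add[OF slopeL_bounded grid_bigo_D]]) simp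
  then show "grid_bigo 1 (\<lambda>h i. scaled_smoothness SL h i - (D 1 (grid h i))\<^sup>2)"
    by (rule grid_bigo_cong) (simp add: scaled_smoothness_eq power2_eq_square algebra_simps)
  have "grid_bigo 1 (\<lambda>h i. (slopeR h i - D 1 (grid h i)) * (slopeR h i + D 1 (grid h i)))"
    by (rule grid_bigo_mult[OF slopeR_near grid_bigo_add[OF slopeR_bounded grid_bigo_D]]) simp
  then show "grid_bigo 1 (\<lambda>h i. scaled_smoothness SR h i - (D 1 (grid h i))\<^sup>2)"
    by (rule grid_bigo_cong) (simp add: scaled_smoothness_eq power2_eq_square algebra_simps)
qed

text \<open>With g the difference of the right and left slopes s_R and s_L, the gaps are 13/3 g^2 +
  g (s_R + 3 s_L) / 4 and 13/3 g^2 - g (s_L + 3 s_R) / 4; since g is O(h), the constant 13/3 affects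
  only the second order. The explicit factors 1 and -1 match the parameter \<open>c\<close> of
  \<open>rel_weight_CWENO23\<close>, which treats both sides at once.\<close>

lemma scaled_smoothness_gap:
  shows "grid_bigo 2 (\<lambda>h i. scaled_smoothness SC h i - scaled_smoothness SL h i
      - 1 * (h * (D 1 (grid h i) * D 2 (grid h i))))"
    and "grid_bigo 2 (\<lambda>h i. scaled_smoothness SC h i - scaled_smoothness SR h i
      - (- 1) * (h * (D 1 (grid h i) * D 2 (grid h i))))"
proof -
  let ?g = "\<lambda>h i. slopeR h i - slopeL h i"
  let ?q = "\<lambda>h i. ?g h i - h * D 2 (grid h i)"
  have sq: "grid_bigo 2 (\<lambda>h i. ?g h i * ?g h i)"
    by (rule grid_bigo_mult[OF slope_gap_bound slope_gap_bound]) simp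
  have hD: "grid_bigo 1 (\<lambda>h i. h ^ 1 * D 2 (grid h i))"
    by (rule grid_bigo_power_mult[OF grid_bigo_D]) simp
  \<comment> \<open>For \<open>b\<close> close to \<open>4 u'\<close>, the product \<open>g b / 4\<close> agrees with \<open>h u' u''\<close> up to second order.\<close>
  have prod: "grid_bigo 2 (\<lambda>h i. 1 / 4 * ((h ^ 1 * D 2 (grid h i)) * (b h i - 4 * D 1 (grid h i)) + ?q h i * b h i))"
    if "grid_bigo 1 (\<lambda>h i. b h i - 4 * D 1 (grid h i))" "grid_bigo 0 b" for b
    by (intro grid_bigo_cmult grid_bigo_add grid_bigo_mult[OF hD that(1)]
        grid_bigo_mult[OF slope_gap that(2)]) auto
  have "grid_bigo 2 (\<lambda>h i. 1 / 4 * ((h ^ 1 * D 2 (grid h i)) * ((slopeR h i + 3 * slopeL h i) - 4 * D 1 (grid h i))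
      + ?q h i * (slopeR h i + 3 * slopeL h i)))"
  proof (rule prod)
    show "grid_bigo 1 (\<lambda>h i. (slopeR h i + 3 * slopeL h i) - 4 * D 1 (grid h i))"
      by (rule grid_bigo_cong[OF grid_bigo_add[OF slopeR_near grid_bigo_cmult[OF slopeL_near, of 3]]]) simp
    show "grid_bigo 0 (\<lambda>h i. slopeR h i + 3 * slopeL h i)"
      by (intro grid_bigo_add grid_bigo_cmult slopeL_bounded slopeR_bounded)
  qed
  from grid_bigo_add[OF grid_bigo_cmult[OF sq, of "13 / 3"] this]
  show "grid_bigo 2 (\<lambda>h i. scaled_smoothness SC h i - scaled_smoothness SL h i
      - 1 * (h * (D 1 (grid h i) * D 2 (grid h i))))"
    by (rule grid_bigo_cong) (simp add: scaled_smoothness_eq power2_eq_square field_simps)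
  have "grid_bigo 2 (\<lambda>h i. 1 / 4 * ((h ^ 1 * D 2 (grid h i)) * ((slopeL h i + 3 * slopeR h i) - 4 * D 1 (grid h i))
      + ?q h i * (slopeL h i + 3 * slopeR h i)))"
  proof (rule prod)
    show "grid_bigo 1 (\<lambda>h i. (slopeL h i + 3 * slopeR h i) - 4 * D 1 (grid h i))"
      by (rule grid_bigo_cong[OF grid_bigo_add[OF slopeL_near grid_bigo_cmult[OF slopeR_near, of 3]]]) simp
    show "grid_bigo 0 (\<lambda>h i. slopeL h i + 3 * slopeR h i)"
      by (intro grid_bigo_add grid_bigo_cmult slopeL_bounded slopeR_bounded)
  qed
  from grid_bigo_diff[OF grid_bigo_cmult[OF sq, of "13 / 3"] this]
  show "grid_bigo 2 (\<lambda>h i. scaled_smoothness SC h i - scaled_smoothness SR h i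
      - (- 1) * (h * (D 1 (grid h i) * D 2 (grid h i))))"
    by (rule grid_bigo_cong) (simp add: scaled_smoothness_eq power2_eq_square field_simps)
qed

lemma grid_bigo_DD: "grid_bigo 0 (\<lambda>h i. D j (grid h i) * D k (grid h i))"
  by (rule grid_bigo_mult[OF grid_bigo_D grid_bigo_D]) simp

lemma scaled_smoothness_gap_bound:
  assumes "grid_bigo 2 (\<lambda>h i. scaled_smoothness SC h i - scaled_smoothness m h i
      - c * (h * (D 1 (grid h i) * D 2 (grid h i))))"
  shows "grid_bigo 1 (\<lambda>h i. scaled_smoothness SC h i - scaled_smoothness m h i)"
  by (rule grid_bigo_cong[OF grid_bigo_add[OF grid_bigo_mono[OF assms, of 1]
        grid_bigo_cmult[OF grid_bigo_power_mult[OF grid_bigo_DD[of 1 2], of 1 1], of c]]]) auto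

section \<open>Weight ratios of the two schemes\<close>

lemma denominator_ge_1:
  fixes eps :: "real \<Rightarrow> real" and g :: "real \<Rightarrow> int \<Rightarrow> real"
  assumes "\<forall>\<^sub>F h in at_right 0. h\<^sup>2 \<le> eps h" "\<And>h i. 0 \<le> g h i"
  shows "\<forall>\<^sub>F h in at_right 0. \<forall>i. 1 \<le> eps h / h\<^sup>2 + g h i"
  using assms(1) eventually_at_right_less[of "0::real"]
proof eventually_elim
  case (elim h)
  then have "1 \<le> eps h / h\<^sup>2"
    by (simp add: le_divide_eq)
  with assms(2) show ?case
    by (auto intro: add_increasing2)
qed

text \<open>This is F for CWENO23; the factor 2 comes from its exponent. It is written with exact
  derivatives instead of slopes, so that its jumps follow from those of the derivatives.\<close>

definition skew :: "(real \<Rightarrow> real) \<Rightarrow> real \<Rightarrow> int \<Rightarrow> real" where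
  "skew eps h i = 2 * ((D 1 (grid h i) * D 2 (grid h i)) / (eps h / h\<^sup>2 + (D 1 (grid h i))\<^sup>2))"

lemma skew_bounded:
  assumes "\<forall>\<^sub>F h in at_right 0. h\<^sup>2 \<le> eps h"
  shows "grid_bigo 0 (skew eps)"
  unfolding skew_def
  by (intro grid_bigo_cmult grid_bigo_divide grid_bigo_DD denominator_ge_1 assms) simp

text \<open>The possibly unbounded term \<open>eps h / h\<^sup>2\<close> is the same in both cells
  and drops out of the difference of the denominators, which is a difference of squares of
  u'.\<close>

lemma skew_jump:
  assumes "\<forall>\<^sub>F h in at_right 0. h\<^sup>2 \<le> eps h"
  shows "grid_bigo 1 (\<lambda>h i. skew eps h i - skew eps h (i + 1))"
proof -
  let ?N = "\<lambda>h i. eps h / h\<^sup>2 + (D 1 (grid h i))\<^sup>2"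
  let ?P = "\<lambda>h i. D 1 (grid h i) * D 2 (grid h i)"
  have N: "\<forall>\<^sub>F h in at_right 0. \<forall>i. 1 \<le> ?N h i"
    by (rule denominator_ge_1[OF assms zero_le_power2])
  then have N': "\<forall>\<^sub>F h in at_right 0. \<forall>i. 1 \<le> ?N h (i + 1)"
    by eventually_elim blast
  have DD_jump: "grid_bigo 1 (\<lambda>h i. D j (grid h i) * D k (grid h i)
      - D j (grid h (i + 1)) * D k (grid h (i + 1)))" for j k
    by (rule grid_bigo_cong[OF grid_bigo_add[OF grid_bigo_mult[OF grid_bigo_D_diff[of j] grid_bigo_D[of k], of 1]
          grid_bigo_mult[OF grid_bigo_shift[OF grid_bigo_D[of j]] grid_bigo_D_diff[of k], of 1]]])
      (auto simp: algebra_simps)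
  have "grid_bigo 1 (\<lambda>h i. ?P h (i + 1) *
      (D 1 (grid h i) * D 1 (grid h i) - D 1 (grid h (i + 1)) * D 1 (grid h (i + 1))))"
    by (rule grid_bigo_mult[OF grid_bigo_shift[OF grid_bigo_DD] DD_jump]) simp
  then have "grid_bigo 1 (\<lambda>h i. 2 * ((?P h i - ?P h (i + 1)) / ?N h i
      - ?P h (i + 1) * (D 1 (grid h i) * D 1 (grid h i) - D 1 (grid h (i + 1)) * D 1 (grid h (i + 1)))
        / ?N h i / ?N h (i + 1)))"
    by (intro grid_bigo_cmult grid_bigo_diff[of 1] grid_bigo_divide DD_jump N N')
  then show ?thesis
  proof (rule grid_bigo_cong_ev)
    show "\<forall>\<^sub>F h in at_right 0. \<forall>i. skew eps h i - skew eps h (i + 1) =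
      2 * ((?P h i - ?P h (i + 1)) / ?N h i
      - ?P h (i + 1) * (D 1 (grid h i) * D 1 (grid h i) - D 1 (grid h (i + 1)) * D 1 (grid h (i + 1)))
        / ?N h i / ?N h (i + 1))"
      using N
    proof eventually_elim
      case (elim h)
      have frac: "2 * (p / (e + a\<^sup>2)) - 2 * (q / (e + b\<^sup>2)) =
          2 * ((p - q) / (e + a\<^sup>2) - q * (a * a - b * b) / (e + a\<^sup>2) / (e + b\<^sup>2))"
        if "1 \<le> e + a\<^sup>2" "1 \<le> e + b\<^sup>2" for p q a b e :: real
      proof -
        have "e + a\<^sup>2 \<noteq> 0" "e + b\<^sup>2 \<noteq> 0"
          using that by linarith+
        then show ?thesis
          by (simp add: divide_simps) (simp add: algebra_simps power2_eq_square)
      qed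
      show ?case
        unfolding skew_def by (intro allI frac) (use elim in blast)+
    qed
  qed
qed

text \<open>The ratio is (1 + z)^2 with z = O(h), so z^2 is negligible. Replacing the indicator by
  u'^2 in the denominator changes it by O(h), and the numerator supplies another factor h.\<close>

lemma rel_weight_CWENO23:
  assumes eps: "\<forall>\<^sub>F h in at_right 0. h\<^sup>2 \<le> eps h"
    and m: "lin_weight m = 1 / 4"
    and gap: "grid_bigo 2 (\<lambda>h i. scaled_smoothness SC h i - scaled_smoothness m h i
      - c * (h * (D 1 (grid h i) * D 2 (grid h i))))"
    and near: "grid_bigo 1 (\<lambda>h i. scaled_smoothness m h i - (D 1 (grid h i))\<^sup>2)"
  shows "grid_bigo 2 (\<lambda>h i. rel_weight CWENO23 (eps h) (cell_avg (D 0) h) m i - 1 - c * (h * skew eps h i))"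
proof -
  let ?G = "scaled_smoothness"
  let ?P = "\<lambda>h i. D 1 (grid h i) * D 2 (grid h i)"
  let ?N = "\<lambda>h i. eps h / h\<^sup>2 + ?G m h i"
  let ?NN = "\<lambda>h i. eps h / h\<^sup>2 + (D 1 (grid h i))\<^sup>2"
  define z where "z = (\<lambda>h i. (?G SC h i - ?G m h i) / ?N h i)"
  have N: "\<forall>\<^sub>F h in at_right 0. \<forall>i. 1 \<le> ?N h i"
    by (rule denominator_ge_1[OF eps scaled_smoothness_nonneg])
  have N0: "\<forall>\<^sub>F h in at_right 0. \<forall>i. 1 \<le> ?NN h i"
    by (rule denominator_ge_1[OF eps zero_le_power2])
  have z: "grid_bigo 1 z"
    unfolding z_def by (intro grid_bigo_divide scaled_smoothness_gap_bound[OF gap] N)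
  have zz: "grid_bigo 2 (\<lambda>h i. z h i * z h i)"
    by (rule grid_bigo_mult[OF z z]) simp
  have "grid_bigo 2 (\<lambda>h i. h ^ 1 * (?P h i * (?G m h i - (D 1 (grid h i))\<^sup>2)))"
    by (intro grid_bigo_power_mult[of 1] grid_bigo_mult[OF grid_bigo_DD near]) auto
  then have "grid_bigo 2 (\<lambda>h i. 2 * ((?G SC h i - ?G m h i - c * (h * ?P h i)) / ?N h i
      - c * (h ^ 1 * (?P h i * (?G m h i - (D 1 (grid h i))\<^sup>2)) / ?N h i / ?NN h i)) + z h i * z h i)"
    by (intro grid_bigo_add zz grid_bigo_cmult grid_bigo_diff[of 2] grid_bigo_divide gap N N0)
  then show ?thesis
  proof (rule grid_bigo_cong_ev)
    show "\<forall>\<^sub>F h in at_right 0. \<forall>i. rel_weight CWENO23 (eps h) (cell_avg (D 0) h) m i - 1 - c * (h * skew eps h i)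
      = 2 * ((?G SC h i - ?G m h i - c * (h * ?P h i)) / ?N h i
      - c * (h ^ 1 * (?P h i * (?G m h i - (D 1 (grid h i))\<^sup>2)) / ?N h i / ?NN h i)) + z h i * z h i"
      using N N0 eps eventually_at_right_less[of "0::real"]
    proof eventually_elim
      case (elim h)
      show ?case
      proof
        fix i
        let ?b = "\<lambda>m. smoothness (cell_avg (D 0) h) m i"
        have "0 < eps h"
          using elim by (meson less_le_trans zero_less_power)
        then have pos: "0 < eps h + ?b m" "0 < eps h + ?b SC"
          using smoothness_nonneg by (simp_all add: add_pos_nonneg)
        \<comment> \<open>The linear weights contribute 2 * (1/4) / (1/2) = 1.\<close>
        have "rel_weight CWENO23 (eps h) (cell_avg (D 0) h) m i = ((eps h + ?b SC) / (eps h + ?b m))\<^sup>2"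
          using pos by (simp add: rel_weight_def m power_divide del: smoothness.simps)
        also have "(eps h + ?b SC) / (eps h + ?b m) = 1 + (?b SC - ?b m) / (eps h + ?b m)"
          using pos by (simp add: field_simps del: smoothness.simps)
        also have "(?b SC - ?b m) / (eps h + ?b m) = z h i"
          using elim(4) unfolding z_def scaled_smoothness_def
          by (simp add: diff_divide_distrib[symmetric] add_divide_distrib[symmetric] del: smoothness.simps)
        finally have rel: "rel_weight CWENO23 (eps h) (cell_avg (D 0) h) m i = (1 + z h i)\<^sup>2" .
        have frac: "X / (e + g) - Y / (e + k) = (X - Y) / (e + g) - Y * (g - k) / (e + g) / (e + k)"
          if "1 \<le> e + g" "1 \<le> e + k" for X Y e g k :: real
        proof -
          have "e + g \<noteq> 0" "e + k \<noteq> 0"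
            using that by linarith+
          then show ?thesis
            by (simp add: divide_simps) (simp add: algebra_simps)
        qed
        have "z h i - c * (h * ?P h i) / ?NN h i = (?G SC h i - ?G m h i - c * (h * ?P h i)) / ?N h i
          - c * (h * ?P h i) * (?G m h i - (D 1 (grid h i))\<^sup>2) / ?N h i / ?NN h i"
          unfolding z_def by (rule frac) (use elim in blast)+
        then have diff: "z h i - c * (h * ?P h i) / ?NN h i = (?G SC h i - ?G m h i - c * (h * ?P h i)) / ?N h i
          - c * (h ^ 1 * (?P h i * (?G m h i - (D 1 (grid h i))\<^sup>2)) / ?N h i / ?NN h i)"
          by (simp add: mult.assoc)
        have skew: "c * (h * skew eps h i) = 2 * (c * (h * ?P h i) / ?NN h i)"
          by (simp add: skew_def)
        \<comment> \<open>Here r is z and y is its leading part, so that 2 y is the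
          \<open>skew\<close> term.\<close>
        have square: "(1 + r)\<^sup>2 - 1 - 2 * y = 2 * x + r * r" if "r - y = x" for r x y :: real
          unfolding that[symmetric] by (simp add: power2_eq_square algebra_simps)
        show "rel_weight CWENO23 (eps h) (cell_avg (D 0) h) m i - 1 - c * (h * skew eps h i)
          = 2 * ((?G SC h i - ?G m h i - c * (h * ?P h i)) / ?N h i
          - c * (h ^ 1 * (?P h i * (?G m h i - (D 1 (grid h i))\<^sup>2)) / ?N h i / ?NN h i)) + z h i * z h i"
          unfolding rel skew by (rule square[OF diff])
      qed
    qed
  qed
qed

text \<open>For CWENO23Z, the three quotients \<open>\<tau> / (\<epsilon> + \<beta>)\<close> are of order \<open>h\<close> and agree to that order.\<close>

lemma rel_weight_CWENO23Z:
  assumes eps: "\<forall>\<^sub>F h in at_right 0. h\<^sup>2 \<le> eps h"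
    and m: "lin_weight m = 1 / 4"
    and gap: "grid_bigo 1 (\<lambda>h i. scaled_smoothness SC h i - scaled_smoothness m h i)"
  shows "grid_bigo 2 (\<lambda>h i. rel_weight (CWENO23Z p) (eps h) (cell_avg (D 0) h) m i - 1)"
proof -
  let ?G = "scaled_smoothness"
  let ?N = "\<lambda>m h i. eps h / h\<^sup>2 + ?G m h i"
  define t where "t = (\<lambda>h i. \<bar>?G SR h i - ?G SL h i\<bar>)"
  \<comment> \<open>Chosen so that 1 + y is the quotient of the two bases 1 + tau / (epsilon +
    beta). The numerator is a product of two factors of order h, and each denominator is at least
    1.\<close>
  define y where "y = (\<lambda>h i. t h i * (?G SC h i - ?G m h i) / ?N m h i / ?N SC h i / (1 + t h i / ?N SC h i))"
  have N: "\<forall>\<^sub>F h in at_right 0. \<forall>i. 1 \<le> ?N m h i" for m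
    by (rule denominator_ge_1[OF eps scaled_smoothness_nonneg])
  have N1: "\<forall>\<^sub>F h in at_right 0. \<forall>i. 1 \<le> 1 + t h i / ?N SC h i"
    using N[of SC]
  proof eventually_elim
    case (elim h)
    have "0 \<le> ?N SC h i" for i
      using elim by (meson order_trans zero_le_one)
    then show ?case
      by (simp add: t_def)
  qed
  have "grid_bigo 1 t"
    unfolding t_def
    by (rule grid_bigo_abs) (rule grid_bigo_cong[OF grid_bigo_diff[OF scaled_smoothness_near(2,1)]], simp)
  then have "grid_bigo 2 (\<lambda>h i. t h i * (?G SC h i - ?G m h i))"
    by (rule grid_bigo_mult[OF _ gap]) simp
  then have "grid_bigo (Suc 1) y"
    unfolding y_def by (intro grid_bigo_divide N N1) (simp add: numeral_eq_Suc)
  from grid_bigo_powr[OF this, of p]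
  have "grid_bigo 2 (\<lambda>h i. (1 + y h i) powr p - 1)"
    by (simp add: numeral_eq_Suc)
  then show ?thesis
  proof (rule grid_bigo_cong_ev)
    show "\<forall>\<^sub>F h in at_right 0. \<forall>i. rel_weight (CWENO23Z p) (eps h) (cell_avg (D 0) h) m i - 1
        = (1 + y h i) powr p - 1"
      using N[of m] N[of SC] N1 eventually_at_right_less[of "0::real"]
    proof eventually_elim
      case (elim h)
      show ?case
      proof
        fix i
        let ?v = "cell_avg (D 0) h"
        have scale: "tau ?v i / (eps h + smoothness ?v k i) = t h i / ?N k h i" for k
          using elim(4) unfolding tau_def t_def scaled_smoothness_def
          by (simp add: diff_divide_distrib[symmetric] add_divide_distrib[symmetric] abs_divide
              del: smoothness.simps)
        have Nm: "0 < ?N m h i"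
          using elim(1) by (meson less_le_trans zero_less_one)
        have NC: "0 < ?N SC h i"
          using elim(2) by (meson less_le_trans zero_less_one)
        have t0: "0 \<le> t h i"
          by (simp add: t_def)
        have frac: "(1 + s / (e + a)) / (1 + s / (e + b)) =
            1 + s * (b - a) / (e + a) / (e + b) / (1 + s / (e + b))"
          if "0 \<le> s" "0 < e + a" "0 < e + b" for s e a b :: real
        proof -
          have "e + a \<noteq> 0" "e + b \<noteq> 0" "1 + s / (e + b) \<noteq> 0"
            using that by (auto intro!: pos_add_strict add_pos_nonneg less_imp_neq[symmetric] simp del: add_eq_0_iff)
          moreover have "s / (e + a) - s / (e + b) = s * (b - a) / (e + a) / (e + b)"
            using that by (simp add: divide_simps) (simp add: algebra_simps)
          ultimately show ?thesis
            by (simp add: divide_simps) (simp add: algebra_simps)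
        qed
        have "rel_weight (CWENO23Z p) (eps h) ?v m i =
            (1 + t h i / ?N m h i) powr p / (1 + t h i / ?N SC h i) powr p"
          by (simp add: rel_weight_def m scale del: smoothness.simps)
        also have "\<dots> = ((1 + t h i / ?N m h i) / (1 + t h i / ?N SC h i)) powr p"
          by (rule powr_divide[symmetric])
        also have "\<dots> = (1 + y h i) powr p"
          unfolding y_def frac[OF t0 Nm NC] ..
        finally show "rel_weight (CWENO23Z p) (eps h) ?v m i - 1 = (1 + y h i) powr p - 1"
          by simp
      qed
    qed
  qed
qed

section \<open>Weight estimates for either scheme\<close>

lemma scheme_weights:
  fixes s :: scheme
  assumes eps: "\<forall>\<^sub>F h in at_right 0. h\<^sup>2 \<le> eps h"
  defines "w \<equiv> \<lambda>h. weight s (eps h) (cell_avg (D 0) h)"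
  shows "grid_bigo 2 (\<lambda>h i. w h SC i - 1 / 2)"
    and "\<forall>\<^sub>F h in at_right 0. \<forall>i. w h SL i + w h SC i + w h SR i = 1"
    and "grid_bigo 1 (\<lambda>h i. w h SR i - w h SL i)"
    and "grid_bigo 2 (\<lambda>h i. (w h SR i - w h SL i) - (w h SR (i + 1) - w h SL (i + 1)))"
proof -
  have pos: "\<forall>\<^sub>F h in at_right 0. 0 < eps h"
    using eps eventually_at_right_less[of "0::real"]
    by eventually_elim (meson less_le_trans zero_less_power)
  obtain F where F: "grid_bigo 0 F" "grid_bigo 1 (\<lambda>h i. F h i - F h (i + 1))"
    and LR: "grid_bigo 2 (\<lambda>h i. rel_weight s (eps h) (cell_avg (D 0) h) SL i - 1 - h * F h i)"
      "grid_bigo 2 (\<lambda>h i. rel_weight s (eps h) (cell_avg (D 0) h) SR i - 1 + h * F h i)"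
  proof (cases s)
    case CWENO23
    show thesis
    proof (rule that[OF skew_bounded[OF eps] skew_jump[OF eps]])
      show "grid_bigo 2 (\<lambda>h i. rel_weight s (eps h) (cell_avg (D 0) h) SL i - 1 - h * skew eps h i)"
        using rel_weight_CWENO23[OF eps _ scaled_smoothness_gap(1) scaled_smoothness_near(1)]
        by (simp add: CWENO23)
      show "grid_bigo 2 (\<lambda>h i. rel_weight s (eps h) (cell_avg (D 0) h) SR i - 1 + h * skew eps h i)"
        using rel_weight_CWENO23[OF eps _ scaled_smoothness_gap(2) scaled_smoothness_near(2)]
        by (simp add: CWENO23)
    qed
  next
    case (CWENO23Z p)
    show thesis
    proof (rule that[of "\<lambda>h i. 0"])
      show "grid_bigo 2 (\<lambda>h i. rel_weight s (eps h) (cell_avg (D 0) h) SL i - 1 - h * 0)"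
        using rel_weight_CWENO23Z[OF eps _ scaled_smoothness_gap_bound[OF scaled_smoothness_gap(1)], of p]
        by (simp add: CWENO23Z)
      show "grid_bigo 2 (\<lambda>h i. rel_weight s (eps h) (cell_avg (D 0) h) SR i - 1 + h * 0)"
        using rel_weight_CWENO23Z[OF eps _ scaled_smoothness_gap_bound[OF scaled_smoothness_gap(2)], of p]
        by (simp add: CWENO23Z)
    qed (auto simp: grid_bigo_def intro!: exI[of _ 0])
  qed
  show "grid_bigo 2 (\<lambda>h i. w h SC i - 1 / 2)"
    and "\<forall>\<^sub>F h in at_right 0. \<forall>i. w h SL i + w h SC i + w h SR i = 1"
    and "grid_bigo 1 (\<lambda>h i. w h SR i - w h SL i)"
    and "grid_bigo 2 (\<lambda>h i. (w h SR i - w h SL i) - (w h SR (i + 1) - w h SL (i + 1)))"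
    unfolding w_def by (rule weights_near_linear[OF pos LR F])+
qed

end

theorem mainTheorem6:
  fixes u :: "real \<Rightarrow> real" and eps :: "real \<Rightarrow> real" and s :: scheme
  assumes "smooth u"
    and "s = CWENO23 \<or> (\<exists>p\<ge>1. s = CWENO23Z p)"
    and "eps = (\<lambda>h. h\<^sup>2) \<or> eps = (\<lambda>h. 1 / 10 ^ 6)"
  shows "grid_bigo 4 (\<lambda>h i. u (grid h i) - R0 s eps u h i)
    \<and> grid_bigo 2 (\<lambda>h i. deriv (deriv u) (grid h i) - R2 s eps u h i)
    \<and> grid_bigo 3 (\<lambda>h i. (deriv u (grid h i) - deriv u (grid h (i + 1)))
                          - (R1 s eps u h i - R1 s eps u h (i + 1)))
    \<and> (\<forall>\<theta>\<in>{0..<1}. grid_bigo 4 (\<lambda>h i. Q s eps u h i \<theta> - sliding_avg u h (grid h i + \<theta> * h)))"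
proof -
  define D where "D k = (deriv ^^ k) u" for k
  interpret derivative_tower D
  proof
    fix k x
    have "D k differentiable (at x)"
      using assms(1) by (simp add: smooth_def D_def)
    then show "(D k has_real_derivative D (Suc k) x) (at x)"
      by (simp add: D_def DERIV_deriv_iff_real_differentiable)
  qed
  have D: "D 0 = u" "D 1 = deriv u" "D 2 = deriv (deriv u)"
    by (simp_all add: D_def numeral_2_eq_2)
  have "\<forall>\<^sub>F h in at_right 0. h\<^sup>2 \<le> eps h"
  proof (rule eventually_at_right_0I)
    fix h :: real
    \<comment> \<open>The threshold is the square root of the fixed parameter 10^-6.\<close>
    assume "0 < h" "h < 1 / 10 ^ 3"
    then have "h\<^sup>2 \<le> (1 / 10 ^ 3)\<^sup>2"
      by (intro power_mono) auto
    with assms(3) show "h\<^sup>2 \<le> eps h"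
      by (auto simp: power_divide)
  qed simp
  note coeffs = coefficients_accuracy[OF scheme_weights[OF this, of s], unfolded D]
  have e0: "grid_bigo 4 (\<lambda>h i. u (grid h i) - R0 s eps u h i)"
    and e1: "grid_bigo 3 (\<lambda>h i. (deriv u (grid h i) - deriv u (grid h (i + 1)))
      - (R1 s eps u h i - R1 s eps u h (i + 1)))"
    and e2: "grid_bigo 2 (\<lambda>h i. deriv (deriv u) (grid h i) - R2 s eps u h i)"
    unfolding R0_def R1_def R2_def by (rule coeffs)+
  have "grid_bigo 4 (\<lambda>h i. Q s eps u h i \<theta> - sliding_avg u h (grid h i + \<theta> * h))"
    if "\<theta> \<in> {0..<1}" for \<theta>
    using reconstruction_accuracy[unfolded D, OF e0 e1 e2, of \<theta>] that
    unfolding Q_def Rpoly_def by simp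
  with e0 e1 e2 show ?thesis
    by blast
qed

end
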